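(* For every decorated tree $T$, $\operatorname{mir}(\mathrm{I}(T))=\mathrm{I}(h_{\mathcal T}(T))$; equivalently, on synchronized intervals, $\operatorname{mir}=\mathrm{I}\circ h_{\mathcal T}\circ\mathrm{I}^{-1}$.
   Context: Dyck paths: (possibly empty) words in $u,d$ with equally many of each letter and every prefix having at least as many $u$ as $d$; size = number of $u$. The Tamari order on Dyck paths of size $n$ is the transitive closure of $VdD_1W\preceq VD_1dW$ ($V,W$ words, $D_1$ a nonempty Dyck path). The type of a Dyck path of size $n$ is $w\in\{N,E\}^{n-1}$ with $w_k=E$ iff the $k$-th up step is immediately followed by an up step. A synchronized interval of order $n\ge1$ is a pair $[P,Q]$ of Dyck paths of size $n$ with $P\preceq Q$ and of the same type. Every nonempty Dyck path is uniquely $D_1uD_2d$ with $D_1,D_2$ Dyck paths; $\operatorname{mir}(\epsilon)=\epsilon$, $\operatorname{mir}(D_1uD_2d)=\operatorname{mir}(D_2)u\operatorname{mir}(D_1)d$, and for an interval $\operatorname{mir}([P,Q])=[\operatorname{mir}(Q),\operatorname{mir}(P)]$ (which maps synchronized intervals to synchronized intervals). Decorated trees: depth of the root is $0$, traversal order is preorder (left-to-right). A decorated tree is a rooted plane tree with at least one edge, each leaf labeled by an integer $\ge-1$, such that (1) each leaf label is strictly less than the depth of its parent; (2) every internal node of depth $p>0$ has a descendant leaf labeled $\le p-2$; (3) for every internal node $t$ of depth $p$, every subtree $T''$ rooted at a child of $t$ and every leaf $\ell$ of $T''$ labeled $p$, the leaves of $T''$ preceding $\ell$ have labels $\ge p$.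 Free leaves are labeled $-1$; $\operatorname{fl}(T)$ counts them. $\Pi_{\mathcal T}(T)$ (root with one child) deletes the root and subtracts $1$ from every non-free leaf label. For $T$ whose root has $\ge2$ children, $T_{hd}$ is the root with its leftmost child and that child's subtree, $T_{tl}$ the root with its other children and their subtrees. The rightmost path goes from the root to the last leaf, $\operatorname{rpath}$ is its number of edges, its nodes are numbered $1,2,\dots$ from the root. $h_{\mathcal T}$, recursively: root with a single leaf child: $h_{\mathcal T}(T)=T$. Root with a single internal child: with $T'=\Pi_{\mathcal T}(T)$, $i=\operatorname{fl}(T)$, $h_{\mathcal T}(T)$ is $h_{\mathcal T}(T')$ with a new free leaf attached as rightmost child of the $i$-th node of its rightmost path. Root with $\ge2$ children, leftmost a leaf: with $T'$ = $T$ without that leaf, $h_{\mathcal T}(T)$ is $h_{\mathcal T}(T')$ with a new free leaf attached as child of its rightmost leaf. Root with $\ge2$ children, leftmost internal: let $T_1'=h_{\mathcal T}(T_{hd})$, $T_2'=h_{\mathcal T}(T_{tl})$, $r=\operatorname{rpath}(T_2')$, $\ell$ the rightmost leaf of $T_2'$; add $r$ to the label of every leaf of $T_1'$ except its rightmost one and replace $\ell$ in $T_2'$ by the resulting tree. The map $\mathrm{I}$ (a bijection from decorated trees with $n$ edges to synchronized intervals of order $n$): for a non-root internal node $x$ of depth $p$, its certificate is the first leaf in traversal order among its descendants with label $\le p-2$; $c(\ell)$ is the number of nodes with certificate $\ell$. In a left-to-right depth-first traversal, $\mathrm{Q}(T)$ records $u$ for each edge descended and $d$ for each edge ascended; $\mathrm{P}(T)$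 records $u$ for each edge descended and $d^{c(\ell)+1}$ upon reaching each leaf $\ell$. $\mathrm{I}(T)=[\mathrm{P}(T),\mathrm{Q}(T)]$. *)

theory Defs
  imports Main
begin

section \<open>Dyck paths, the Tamari order and synchronized intervals\<close>

datatype step = Up | Down

definition dyck :: "step list \<Rightarrow> bool" where
  "dyck w \<longleftrightarrow> count_list w Up = count_list w Down \<and>
     (\<forall>k\<le>length w. count_list (take k w) Down \<le> count_list (take k w) Up)"

definition dyck_size :: "step list \<Rightarrow> nat" where
  "dyck_size w = count_list w Up"

definition tamari_step :: "step list \<Rightarrow> step list \<Rightarrow> bool" where
  "tamari_step P Q \<longleftrightarrow> dyck P \<and> dyck Q \<and>
     (\<exists>V D1 W. dyck D1 \<and> D1 \<noteq> [] \<and> P = V @ [Down] @ D1 @ W \<and> Q = V @ D1 @ [Down] @ W)"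

definition tamari_le :: "step list \<Rightarrow> step list \<Rightarrow> bool" where
  "tamari_le = tamari_step\<^sup>*\<^sup>*"

datatype type_letter = North | East

fun up_letters :: "step list \<Rightarrow> type_letter list" where
  "up_letters [] = []"
| "up_letters (Down # w) = up_letters w"
| "up_letters (Up # w) = (if w \<noteq> [] \<and> hd w = Up then East else North) # up_letters w"

text \<open>The last up step does not contribute: the type of a path of size \<open>n\<close> has length \<open>n - 1\<close>.\<close>

definition dyck_type :: "step list \<Rightarrow> type_letter list" where
  "dyck_type w = butlast (up_letters w)"

definition sync_intervals :: "nat \<Rightarrow> (step list \<times> step list) set" where
  "sync_intervals n = {(P, Q). dyck P \<and> dyck Q \<and> dyck_size P = n \<and> dyck_size Q = n \<and>
     tamari_le P Q \<and> dyck_type P = dyck_type Q}"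


section \<open>The mirror map\<close>

lemma dyck_decomp_exists:
  assumes "dyck w" "w \<noteq> []"
  shows "\<exists>D1 D2. dyck D1 \<and> dyck D2 \<and> w = D1 @ Up # D2 @ [Down]"
proof -
  define h where "h k = int (count_list (take k w) Up) - int (count_list (take k w) Down)" for k
  have h0: "h 0 = 0" by (simp add: h_def)
  have hn: "h (length w) = 0" using assms(1) by (simp add: h_def dyck_def)
  have hpos: "h k \<ge> 0" if "k \<le> length w" for k
    using assms(1) that by (simp add: h_def dyck_def)
  have hS: "h (Suc k) = h k + (if w ! k = Up then 1 else -1)" if "k < length w" for k
    using that by (cases "w ! k") (simp_all add: h_def take_Suc_conv_app_nth)
  define K where "K = {k. k < length w \<and> h k = 0}"
  define k where "k = Max K"
  have fin: "finite K" by (simp add: K_def)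
  have ne: "0 \<in> K" using assms(2) h0 by (simp add: K_def)
  have kK: "k \<in> K" using Max_in[OF fin] ne by (auto simp: k_def)
  then have kl: "k < length w" and hk: "h k = 0" by (auto simp: K_def)
  have later: "h j \<ge> 1" if "k < j" "j < length w" for j
  proof -
    have "j \<notin> K" using Max_ge[OF fin, of j] that by (auto simp: k_def)
    then show ?thesis using hpos[of j] that by (auto simp: K_def)
  qed
  have wk: "w ! k = Up" using hS[OF kl] hpos[of "Suc k"] kl hk by (auto split: if_splits)
  have hk1: "h (Suc k) = 1" using hS[OF kl] wk hk by simp
  have kl1: "Suc k < length w"
    using kl hk1 hn by (metis Suc_lessI zero_neq_one)
  define m where "m = length w - Suc (Suc k)"
  have lw: "length w = Suc (Suc (k + m))" using kl1 by (simp add: m_def)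
  have last_step: "w ! Suc (k + m) = Down"
  proof (rule ccontr)
    assume "w ! Suc (k + m) \<noteq> Down"
    then have "w ! Suc (k + m) = Up" by (cases "w ! Suc (k + m)") auto
    then have "h (length w) = h (Suc (k + m)) + 1" using hS[of "Suc (k + m)"] lw by simp
    then show False using hn hpos[of "Suc (k + m)"] lw by simp
  qed
  define D1 where "D1 = take k w"
  define D2 where "D2 = take m (drop (Suc k) w)"
  have "w = take k w @ w ! k # drop (Suc k) w" using id_take_nth_drop[OF kl] .
  moreover have "drop (Suc k) w = take m (drop (Suc k) w) @ [w ! Suc (k + m)]"
  proof -
    have "length (drop (Suc k) w) = Suc m" using lw by simp
    moreover have "drop (Suc k) w ! m = w ! Suc (k + m)" using lw by simp
    ultimately show ?thesis using take_Suc_conv_app_nth[of m "drop (Suc k) w"] by simp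
  qed
  ultimately have w: "w = D1 @ Up # D2 @ [Down]"
    using wk last_step by (simp add: D1_def D2_def)
  have l1: "length D1 = k" using kl by (simp add: D1_def)
  have l2: "length D2 = m" using lw by (simp add: D2_def)
  have "dyck D1"
    unfolding dyck_def
  proof (intro conjI allI impI)
    show "count_list D1 Up = count_list D1 Down" using hk by (simp add: h_def D1_def)
    fix j assume "j \<le> length D1"
    then have j: "j \<le> k" using l1 by simp
    then have "take j D1 = take j w" by (simp add: D1_def min_absorb1)
    then show "count_list (take j D1) Down \<le> count_list (take j D1) Up"
      using hpos[of j] j kl by (simp add: h_def)
  qed
  moreover have "dyck D2"
  proof -
    have eq: "h (Suc k + j) = 1 + int (count_list (take j D2) Up) - int (count_list (take j D2) Down)"
      if "j \<le> m" for j
    proof -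
      have "take (Suc k + j) w = D1 @ Up # take j D2"
        using that l1 l2 by (subst w) simp
      moreover have "count_list D1 Up = count_list D1 Down" using hk by (simp add: h_def D1_def)
      ultimately show ?thesis by (simp add: h_def)
    qed
    have "h (length w) = h (Suc (k + m)) - 1" using hS[of "Suc (k + m)"] lw last_step by simp
    then have hend: "h (Suc k + m) = 1" using hn by simp
    show ?thesis
      unfolding dyck_def
    proof (intro conjI allI impI)
      show "count_list D2 Up = count_list D2 Down" using eq[of m] hend l2 by simp
      fix j assume "j \<le> length D2"
      then have j: "j \<le> m" using l2 by simp
      have "h (Suc k + j) \<ge> 1" using later[of "Suc k + j"] j lw by simp
      then show "count_list (take j D2) Down \<le> count_list (take j D2) Up" using eq[OF j] by simp
    qed
  qed
  ultimately show ?thesis using w by blast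
qed

lemma dyck_decomp_length:
  assumes "dyck D1" "dyck D2" "dyck D1'" "D1 @ Up # D2 @ [Down] = D1' @ Up # D2' @ [Down]"
  shows "length D1' \<le> length D1"
proof (rule ccontr)
  assume "\<not> length D1' \<le> length D1"
  then have len: "length D1 < length D1'" by simp
  define j where "j = length D1' - Suc (length D1)"
  have lj: "length D1' = Suc (length D1 + j)" using len by (simp add: j_def)
  have "length (D1 @ Up # D2 @ [Down]) = length (D1' @ Up # D2' @ [Down])"
    by (simp only: assms(4))
  then have j: "j \<le> length D2" using lj by simp
  have "D1' = take (length D1') (D1 @ Up # D2 @ [Down])" by (simp add: assms(4))
  also have "\<dots> = D1 @ Up # take j D2" using lj j by simp
  finally have "D1' = D1 @ Up # take j D2" .
  moreover have "count_list (take j D2) Down \<le> count_list (take j D2) Up"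
    using assms(2) j by (simp add: dyck_def)
  ultimately show False using assms(1,3) by (simp add: dyck_def)
qed

lemma dyck_decomp_unique:
  assumes "dyck D1" "dyck D2" "dyck D1'" "dyck D2'"
    and "D1 @ Up # D2 @ [Down] = D1' @ Up # D2' @ [Down]"
  shows "D1 = D1' \<and> D2 = D2'"
  using dyck_decomp_length[OF assms(1-3,5)] dyck_decomp_length[OF assms(3,4,1) assms(5)[symmetric]]
    assms(5) by simp

definition dyck_decomp :: "step list \<Rightarrow> step list \<times> step list" where
  "dyck_decomp w = (THE (D1, D2). dyck D1 \<and> dyck D2 \<and> w = D1 @ Up # D2 @ [Down])"

lemma dyck_decomp_eq:
  assumes "dyck D1" "dyck D2"
  shows "dyck_decomp (D1 @ Up # D2 @ [Down]) = (D1, D2)"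
  unfolding dyck_decomp_def
proof (rule the_equality)
  show "case (D1, D2) of (A, B) \<Rightarrow> dyck A \<and> dyck B \<and> D1 @ Up # D2 @ [Down] = A @ Up # B @ [Down]"
    using assms by simp
next
  fix p
  assume "case p of (A, B) \<Rightarrow> dyck A \<and> dyck B \<and> D1 @ Up # D2 @ [Down] = A @ Up # B @ [Down]"
  then show "p = (D1, D2)" using dyck_decomp_unique[OF assms] by (cases p) auto
qed

text \<open>Words that are not Dyck paths are sent to \<open>[]\<close>; see \<open>mir_Nil\<close> and \<open>mir_decomp\<close>
  below for the defining equations on Dyck paths.\<close>

function mir :: "step list \<Rightarrow> step list" where
  "mir w = (if dyck w \<and> w \<noteq> []
     then mir (snd (dyck_decomp w)) @ Up # mir (fst (dyck_decomp w)) @ [Down]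
     else [])"
  by pat_completeness auto

lemma dyck_decomp_less:
  assumes "dyck w \<and> w \<noteq> []"
  shows "length (fst (dyck_decomp w)) < length w \<and> length (snd (dyck_decomp w)) < length w"
  using dyck_decomp_exists[of w] dyck_decomp_eq assms by fastforce

termination
  by (relation "measure length") (simp_all add: dyck_decomp_less)

declare mir.simps [simp del]

lemma mir_Nil: "mir [] = []"
  by (simp add: mir.simps)

lemma dyck_compose:
  assumes "dyck D1" "dyck D2"
  shows "dyck (D1 @ Up # D2 @ [Down])"
  unfolding dyck_def
proof (intro conjI allI impI)
  show "count_list (D1 @ Up # D2 @ [Down]) Up = count_list (D1 @ Up # D2 @ [Down]) Down"
    using assms by (simp add: dyck_def)
next
  fix k assume k: "k \<le> length (D1 @ Up # D2 @ [Down])"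
  have p: "count_list (take j w) Down \<le> count_list (take j w) Up" if "dyck w" for j w
    using that by (cases "j \<le> length w") (auto simp: dyck_def)
  have e: "count_list D1 Up = count_list D1 Down" "count_list D2 Up = count_list D2 Down"
    using assms by (auto simp: dyck_def)
  show "count_list (take k (D1 @ Up # D2 @ [Down])) Down
      \<le> count_list (take k (D1 @ Up # D2 @ [Down])) Up"
  proof (cases "k \<le> length D1")
    case True
    then show ?thesis using p[OF assms(1), of k] by simp
  next
    case False
    then obtain i where i: "k = Suc (length D1 + i)"
      by (metis add_Suc_right less_imp_Suc_add not_le)
    show ?thesis
    proof (cases "i \<le> length D2")
      case True
      then show ?thesis using i e p[OF assms(2), of i] by simp
    next
      case False
      then have "i = Suc (length D2)" using k i by simp
      then show ?thesis using i e by simp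
    qed
  qed
qed

lemma mir_decomp:
  assumes "dyck D1" "dyck D2"
  shows "mir (D1 @ Up # D2 @ [Down]) = mir D2 @ Up # mir D1 @ [Down]"
  by (subst mir.simps) (simp add: dyck_compose assms dyck_decomp_eq)

definition mir_interval :: "step list \<times> step list \<Rightarrow> step list \<times> step list" where
  "mir_interval = (\<lambda>(P, Q). (mir Q, mir P))"


section \<open>Decorated trees\<close>

datatype 'a ltree = Leaf 'a | Node "'a ltree list"

text \<open>Leaf labels in traversal order.\<close>

fun leaves :: "'a ltree \<Rightarrow> 'a list" where
  "leaves (Leaf a) = [a]"
| "leaves (Node ts) = concat (map leaves ts)"

fun edges :: "'a ltree \<Rightarrow> nat" where
  "edges (Leaf a) = 0"
| "edges (Node ts) = (\<Sum>t\<leftarrow>ts. Suc (edges t))"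

text \<open>
  Leaves are identified with their positions \<open>0, 1, \<dots>\<close> in traversal order.
  \<open>inner p k t\<close> lists the internal nodes of \<open>t\<close> in traversal order, where the root of \<open>t\<close> is
  taken to have depth \<open>p\<close> and the first leaf of \<open>t\<close> to have position \<open>k\<close>.  A node is recorded
  as the triple of its depth, the position of its first descendant leaf, and the list of the
  subtrees rooted at its children.
\<close>

fun inner :: "nat \<Rightarrow> nat \<Rightarrow> 'a ltree \<Rightarrow> (nat \<times> nat \<times> 'a ltree list) list"
  and inner_list :: "nat \<Rightarrow> nat \<Rightarrow> 'a ltree list \<Rightarrow> (nat \<times> nat \<times> 'a ltree list) list" where
  "inner p k (Leaf a) = []"
| "inner p k (Node ts) = (p, k, ts) # inner_list (Suc p) k ts"
| "inner_list p k [] = []"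
| "inner_list p k (t # ts) = inner p k t @ inner_list p (k + length (leaves t)) ts"

text \<open>\<open>ts \<noteq> []\<close> below excludes \<open>Node []\<close>: a node without children is a \<open>Leaf\<close>.\<close>

definition decorated :: "int ltree \<Rightarrow> bool" where
  "decorated T \<longleftrightarrow> edges T \<ge> 1 \<and>
     (\<forall>(p, k, ts) \<in> set (inner 0 0 T).
        ts \<noteq> [] \<and>
        (\<forall>a. Leaf a \<in> set ts \<longrightarrow> -1 \<le> a \<and> a < int p) \<and>
        (p > 0 \<longrightarrow> (\<exists>a \<in> set (leaves (Node ts)). a \<le> int p - 2)) \<and>
        (\<forall>t \<in> set ts. \<forall>i < length (leaves t). leaves t ! i = int p \<longrightarrow>
           (\<forall>j < i. leaves t ! j \<ge> int p)))"

definition decorated_trees :: "nat \<Rightarrow> int ltree set" where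
  "decorated_trees n = {T. decorated T \<and> edges T = n}"

definition free_leaves :: "int ltree \<Rightarrow> nat" where
  "free_leaves T = count_list (leaves T) (-1)"


section \<open>The map from decorated trees to synchronized intervals\<close>

text \<open>The position of the certificate of a node of \<open>inner 0 0 T\<close>.\<close>

definition certificate :: "nat \<times> nat \<times> int ltree list \<Rightarrow> nat" where
  "certificate = (\<lambda>(p, k, ts).
     k + (LEAST i. i < length (leaves (Node ts)) \<and> leaves (Node ts) ! i \<le> int p - 2))"

definition cert_count :: "int ltree \<Rightarrow> nat \<Rightarrow> nat" where
  "cert_count T l = length (filter (\<lambda>x. fst x > 0 \<and> certificate x = l) (inner 0 0 T))"

fun Q_path :: "'a ltree \<Rightarrow> step list" where
  "Q_path (Leaf a) = []"
| "Q_path (Node ts) = concat (map (\<lambda>t. Up # Q_path t @ [Down]) ts)"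

text \<open>\<open>P_word c k t\<close> is the word read on \<open>t\<close> when its first leaf has position \<open>k\<close>.\<close>

fun P_word :: "(nat \<Rightarrow> nat) \<Rightarrow> nat \<Rightarrow> 'a ltree \<Rightarrow> step list"
  and P_word_list :: "(nat \<Rightarrow> nat) \<Rightarrow> nat \<Rightarrow> 'a ltree list \<Rightarrow> step list" where
  "P_word c k (Leaf a) = replicate (c k + 1) Down"
| "P_word c k (Node ts) = P_word_list c k ts"
| "P_word_list c k [] = []"
| "P_word_list c k (t # ts) = Up # P_word c k t @ P_word_list c (k + length (leaves t)) ts"

definition P_path :: "int ltree \<Rightarrow> step list" where
  "P_path T = P_word (cert_count T) 0 T"

definition interval_of :: "int ltree \<Rightarrow> step list \<times> step list" where
  "interval_of T = (P_path T, Q_path T)"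


section \<open>The map on decorated trees\<close>

lemma size_last_ltree [termination_simp]:
  assumes "ts \<noteq> []"
  shows "size (last ts) < Suc (size_list size ts)"
proof -
  have "size (last ts) \<le> size_list size ts"
    using size_list_estimation'[OF last_in_set[OF assms], of "size (last ts)" size] by simp
  then show ?thesis by simp
qed

fun rpath :: "'a ltree \<Rightarrow> nat" where
  "rpath (Leaf a) = 0"
| "rpath (Node ts) = (if ts = [] then 0 else Suc (rpath (last ts)))"

text \<open>New free leaf as rightmost child of the \<open>i\<close>-th node of the rightmost path, the root being
  the first one.  (If this node is a leaf or does not exist, the tree is left unchanged.)\<close>

fun attach :: "nat \<Rightarrow> int ltree \<Rightarrow> int ltree" where
  "attach i (Leaf a) = Leaf a"
| "attach i (Node ts) =
     (if i \<le> 1 then Node (ts @ [Leaf (-1)])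
      else if ts = [] then Node []
      else Node (butlast ts @ [attach (i - 1) (last ts)]))"

text \<open>Replaces the rightmost leaf of the second argument by the first argument.\<close>

fun graft :: "'a ltree \<Rightarrow> 'a ltree \<Rightarrow> 'a ltree" where
  "graft s (Leaf a) = s"
| "graft s (Node ts) = (if ts = [] then Node [] else Node (butlast ts @ [graft s (last ts)]))"

text \<open>Adds \<open>r\<close> to the label of every leaf except the rightmost one.\<close>

fun shift :: "int \<Rightarrow> int ltree \<Rightarrow> int ltree" where
  "shift r (Leaf a) = Leaf a"
| "shift r (Node ts) =
     (if ts = [] then Node []
      else Node (map (map_ltree (\<lambda>a. a + r)) (butlast ts) @ [shift r (last ts)]))"

text \<open>The deletion of the root of \<open>Node [t]\<close>, as a function of \<open>t\<close>.\<close>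

definition Pi_tree :: "int ltree \<Rightarrow> int ltree" where
  "Pi_tree t = map_ltree (\<lambda>a. if a = -1 then -1 else a - 1) t"

lemma edges_map_ltree [simp]: "edges (map_ltree f t) = edges t"
  by (induction t) (simp_all add: comp_def cong: map_cong)

text \<open>The first two equations are irrelevant on decorated trees.
  The others are the four cases of the recursion.\<close>

function h_tree :: "int ltree \<Rightarrow> int ltree" where
  "h_tree (Leaf a) = Leaf a"
| "h_tree (Node []) = Node []"
| "h_tree (Node [Leaf a]) = Node [Leaf a]"
| "h_tree (Node [Node ts]) =
     attach (free_leaves (Node [Node ts])) (h_tree (Pi_tree (Node ts)))"
| "h_tree (Node (Leaf a # t # ts)) = graft (Node [Leaf (-1)]) (h_tree (Node (t # ts)))"
| "h_tree (Node (Node ss # t # ts)) =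
     (let T1 = h_tree (Node [Node ss]); T2 = h_tree (Node (t # ts))
      in graft (shift (int (rpath T2)) T1) T2)"
  by pat_completeness auto
termination
  by (relation "measure edges") (simp_all add: Pi_tree_def comp_def)

end

theory Submission
  imports Defs
begin

text \<open>
  Cut the lower path \<open>P\<close> of a decorated tree at its returns to the axis: these happen exactly at
  the free leaves.  If the root has several children, both paths are concatenations, and the
  mirror of \<open>A @ B\<close> is the mirror of \<open>B\<close> with the mirror of \<open>A\<close> inserted into its last peak; this
  is what grafting does to both paths, the shift of the labels making the new last leaf the
  certificate of the grafted node.  If the root has a single internal child, then \<open>Q = u Q' d\<close>,
  \<open>P = u L d R\<close> and \<open>P' = L R\<close>, where \<open>R\<close> has \<open>i - 1\<close> returns; mirroring appends \<open>u d\<close> to the mirror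
  of \<open>Q'\<close> and inserts \<open>u d\<close> before the last \<open>i - 1\<close> down steps of the mirror of \<open>P'\<close>, which is the
  effect of attaching a free leaf to the \<open>i\<close>-th node of the rightmost path.

  For the statement on intervals only the surjectivity of \<open>interval_of\<close> is needed.  Tamari steps
  are compatible with splitting \<open>Q\<close> at a return and with deleting the first up step together with
  its matching down step, so an interval is built by the same two operations.
\<close>

section \<open>Certificates read off the traversal\<close>

text \<open>Condition (3) for one child subtree, as a property of its list of leaf labels;
  splittings rather than positions suit concatenation.\<close>

definition guarded :: "int \<Rightarrow> int list \<Rightarrow> bool" where
  "guarded p xs \<longleftrightarrow> (\<forall>ys zs. xs = ys @ p # zs \<longrightarrow> (\<forall>y\<in>set ys. p \<le> y))"

lemma guarded_nth:
  "guarded p xs \<longleftrightarrow> (\<forall>i<length xs. xs ! i = p \<longrightarrow> (\<forall>j<i. xs ! j \<ge> p))"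
proof
  assume g: "guarded p xs"
  show "\<forall>i<length xs. xs ! i = p \<longrightarrow> (\<forall>j<i. xs ! j \<ge> p)"
  proof (intro allI impI)
    fix i j assume i: "i < length xs" "xs ! i = p" and j: "j < i"
    have "xs = take i xs @ p # drop (Suc i) xs" using id_take_nth_drop[OF i(1)] i(2) by simp
    moreover have "xs ! j \<in> set (take i xs)" using i(1) j by (auto simp: in_set_conv_nth)
    ultimately show "p \<le> xs ! j" using g unfolding guarded_def by blast
  qed
next
  assume n: "\<forall>i<length xs. xs ! i = p \<longrightarrow> (\<forall>j<i. xs ! j \<ge> p)"
  show "guarded p xs" unfolding guarded_def
  proof (intro allI impI ballI)
    fix ys zs y assume xs: "xs = ys @ p # zs" and "y \<in> set ys"
    then obtain j where j: "j < length ys" "y = ys ! j" by (auto simp: in_set_conv_nth)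
    have "xs ! length ys = p" "length ys < length xs" using xs by auto
    then have "p \<le> xs ! j" using n j(1) by blast
    then show "p \<le> y" using xs j by (simp add: nth_append)
  qed
qed

text \<open>Condition (1) on a leaf is phrased through its own depth \<open>p\<close>, so its parent is at
  depth \<open>p - 1\<close>.\<close>

fun wf_at :: "nat \<Rightarrow> int ltree \<Rightarrow> bool" where
  "wf_at p (Leaf a) \<longleftrightarrow> -1 \<le> a \<and> a < int p - 1"
| "wf_at p (Node ts) \<longleftrightarrow> ts \<noteq> [] \<and>
     (p > 0 \<longrightarrow> (\<exists>t\<in>set ts. \<exists>a\<in>set (leaves t). a \<le> int p - 2)) \<and>
     (\<forall>t\<in>set ts. guarded (int p) (leaves t) \<and> wf_at (Suc p) t)"

text \<open>\<open>inner\<close> lists no leaves, so condition (1) is checked at the parent there,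
  but at the leaf itself in \<open>wf_at\<close>. The conjunct about \<open>Leaf a\<close> bridges
  the two when a leaf has no parent in view.\<close>

lemma wf_at_inner:
  defines "ok \<equiv> \<lambda>(p, k :: nat, ts).
        ts \<noteq> [] \<and>
        (\<forall>a. Leaf a \<in> set ts \<longrightarrow> -1 \<le> a \<and> a < int p) \<and>
        (p > 0 \<longrightarrow> (\<exists>a \<in> set (leaves (Node ts)). a \<le> int p - 2)) \<and>
        (\<forall>t \<in> set ts. \<forall>i < length (leaves t). leaves t ! i = int p \<longrightarrow>
           (\<forall>j < i. leaves t ! j \<ge> int p))"
  shows "(\<forall>x\<in>set (inner p k t). ok x) \<and> (\<forall>a. t = Leaf a \<longrightarrow> -1 \<le> a \<and> a < int p - 1) \<longleftrightarrow> wf_at p t"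
    and "(\<forall>x\<in>set (inner_list p k ts). ok x) \<and> (\<forall>a. Leaf a \<in> set ts \<longrightarrow> -1 \<le> a \<and> a < int p - 1) \<longleftrightarrow>
      (\<forall>t\<in>set ts. wf_at p t)"
proof (induction p k t and p k ts rule: inner_inner_list.induct)
  case (2 p k ts)
  then show ?case by (auto simp: ok_def guarded_nth)
next
  case (4 p k t ts)
  then show ?case by (simp add: ball_Un) blast
qed simp_all

text \<open>At depth 0 a lone leaf fails \<open>wf_at\<close>, since -1 <= a < -1 is impossible; so
  \<open>wf_at 0\<close> already forces an edge.\<close>

lemma decorated_iff: "decorated T \<longleftrightarrow> wf_at 0 T"
proof (cases T)
  case (Leaf a)
  then show ?thesis by (simp add: decorated_def)
next
  case (Node ts)
  have "edges (Node ts) \<ge> 1" if "ts \<noteq> []" using that by (cases ts) auto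
  then have "wf_at 0 T \<Longrightarrow> edges T \<ge> 1" using Node by simp
  then show ?thesis using wf_at_inner(1)[of 0 0 T] Node unfolding decorated_def by auto
qed

lemma wf_at_leaves: "wf_at p t \<Longrightarrow> a \<in> set (leaves t) \<Longrightarrow> -1 \<le> a"
  by (induction p t rule: wf_at.induct) auto

lemma leaves_ne: "wf_at p t \<Longrightarrow> leaves t \<noteq> []"
proof (induction p t rule: wf_at.induct)
  case (2 p ts)
  then show ?case by (cases ts) auto
qed simp

text \<open>A word between tree and lower path: it still carries the labels, so certificates can be
  found by scanning it.\<close>

datatype 'a token = Rise | Tip 'a nat

fun path_of :: "'a token list \<Rightarrow> step list" where
  "path_of [] = []"
| "path_of (Rise # xs) = Up # path_of xs"
| "path_of (Tip a d # xs) = replicate d Down @ path_of xs"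

fun labels :: "'a token list \<Rightarrow> 'a list" where
  "labels [] = []"
| "labels (Rise # xs) = labels xs"
| "labels (Tip a d # xs) = a # labels xs"

text \<open>For \<open>m = p - 2\<close> the first label at most \<open>m\<close> belongs to the
  certificate of a node of depth \<open>p\<close>.\<close>

fun bump :: "int \<Rightarrow> int token list \<Rightarrow> int token list" where
  "bump m [] = []"
| "bump m (Rise # xs) = Rise # bump m xs"
| "bump m (Tip a d # xs) = (if a \<le> m then Tip a (Suc d) # xs else Tip a d # bump m xs)"

text \<open>\<open>trace p t\<close> is the traversal of \<open>t\<close>, its root having depth \<open>p\<close>, where a leaf records
  its label and the number of down steps it contributes to the lower path.  Each internal node
  contributes one of these to its certificate.  For the root of a decorated tree the threshold
  is \<open>-2\<close>, below all labels.\<close>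

fun trace :: "nat \<Rightarrow> int ltree \<Rightarrow> int token list" where
  "trace p (Leaf a) = [Tip a 1]"
| "trace p (Node ts) = bump (int p - 2) (concat (map (\<lambda>t. Rise # trace (Suc p) t) ts))"

lemma path_of_append [simp]: "path_of (xs @ ys) = path_of xs @ path_of ys"
  by (induction xs rule: path_of.induct) auto

lemma labels_append [simp]: "labels (xs @ ys) = labels xs @ labels ys"
  by (induction xs rule: labels.induct) auto

lemma labels_bump [simp]: "labels (bump m xs) = labels xs"
  by (induction m xs rule: bump.induct) auto

lemma labels_concat: "labels (concat xss) = concat (map labels xss)"
  by (induction xss) auto

lemma labels_trace [simp]: "labels (trace p t) = leaves t"
  by (induction p t rule: trace.induct) (simp_all add: labels_concat comp_def cong: map_cong)

lemma bump_ident: "(\<And>a. a \<in> set (labels xs) \<Longrightarrow> m < a) \<Longrightarrow> bump m xs = xs"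
  by (induction m xs rule: bump.induct) force+

section \<open>Lower paths from counts of certificates\<close>

fun bare_trace :: "'a ltree \<Rightarrow> 'a token list" where
  "bare_trace (Leaf a) = [Tip a 1]"
| "bare_trace (Node ts) = concat (map (\<lambda>t. Rise # bare_trace t) ts)"

fun add_downs :: "(nat \<Rightarrow> nat) \<Rightarrow> nat \<Rightarrow> 'a token list \<Rightarrow> 'a token list" where
  "add_downs c k [] = []"
| "add_downs c k (Rise # xs) = Rise # add_downs c k xs"
| "add_downs c k (Tip a d # xs) = Tip a (d + c k) # add_downs c (Suc k) xs"

lemma labels_bare_trace [simp]: "labels (bare_trace t) = leaves t"
  by (induction t) (simp_all add: labels_concat comp_def cong: map_cong)

lemma add_downs_append:
  "add_downs c k (xs @ ys) = add_downs c k xs @ add_downs c (k + length (labels xs)) ys"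
  by (induction c k xs rule: add_downs.induct) auto

lemma add_downs_cong:
  "(\<And>l. k \<le> l \<Longrightarrow> l < k + length (labels xs) \<Longrightarrow> c l = c' l) \<Longrightarrow> add_downs c k xs = add_downs c' k xs"
  by (induction c k xs rule: add_downs.induct) auto

lemma add_downs_add_downs:
  "add_downs c k (add_downs c' k xs) = add_downs (\<lambda>l. c' l + c l) k xs"
  by (induction c k xs rule: add_downs.induct) auto

lemma add_downs_zero: "(\<And>l. k \<le> l \<Longrightarrow> c l = 0) \<Longrightarrow> add_downs c k xs = xs"
  by (induction c k xs rule: add_downs.induct) auto

lemma P_word_add_downs:
  fixes t :: "'a ltree" and ts :: "'a ltree list"
  shows "P_word c k t = path_of (add_downs c k (bare_trace t))"
    and "P_word_list c k ts = path_of (add_downs c k (concat (map (\<lambda>t. Rise # bare_trace t) ts)))"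
  by (induction c k t and c k ts rule: P_word_P_word_list.induct)
    (simp_all add: add_downs_append)

lemma bump_add_downs:
  assumes "\<exists>a\<in>set (labels xs). a \<le> m"
  shows "bump m xs =
    add_downs (\<lambda>l. if l = k + (LEAST i. i < length (labels xs) \<and> labels xs ! i \<le> m) then 1 else 0) k xs"
  using assms
proof (induction m xs arbitrary: k rule: bump.induct)
  case (3 m a d xs)
  let ?R = "\<lambda>i. i < length (labels (Tip a d # xs)) \<and> labels (Tip a d # xs) ! i \<le> m"
  show ?case
  proof (cases "a \<le> m")
    case True
    then have "(LEAST i. ?R i) = 0" by (intro Least_eq_0) simp
    then show ?thesis using True by (simp add: add_downs_zero)
  next
    case False
    then have ex: "\<exists>a\<in>set (labels xs). a \<le> m" using 3(2) by simp
    then obtain i where "?R (Suc i)" by (auto simp: in_set_conv_nth)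
    then have "(LEAST i. ?R i) = Suc (LEAST i. ?R (Suc i))"
      using False by (intro Least_Suc[of _ "Suc i"]) auto
    then show ?thesis using False 3(1)[OF False ex, of "Suc k"] by simp
  qed
qed simp_all

lemma certificate_range:
  assumes "\<exists>a\<in>set (leaves (Node ts)). a \<le> int p - 2"
  shows "k \<le> certificate (p, k, ts)" "certificate (p, k, ts) < k + length (leaves (Node ts))"
proof -
  have "\<exists>i. i < length (leaves (Node ts)) \<and> leaves (Node ts) ! i \<le> int p - 2"
    using assms by (metis in_set_conv_nth)
  from LeastI_ex[OF this] show "certificate (p, k, ts) < k + length (leaves (Node ts))"
    by (simp add: certificate_def)
qed (simp add: certificate_def)

text \<open>A certificate is a leaf below its node, so it stays in the block of positions of the
  subtree, and sibling subtrees do not interfere.\<close>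

lemma certificate_inner_range:
  "wf_at p t \<Longrightarrow> x \<in> set (inner p k t) \<Longrightarrow> fst x > 0 \<Longrightarrow>
     k \<le> certificate x \<and> certificate x < k + length (leaves t)"
  "\<forall>t\<in>set ts. wf_at p t \<Longrightarrow> x \<in> set (inner_list p k ts) \<Longrightarrow> fst x > 0 \<Longrightarrow>
     k \<le> certificate x \<and> certificate x < k + length (concat (map leaves ts))"
proof (induction p k t and p k ts rule: inner_inner_list.induct)
  case (2 p k ts)
  then show ?case using certificate_range[of ts p k] by auto
qed fastforce+

text \<open>The count \<open>c\<close> is additive over lists of nodes: a node adds the indicator of
  its certificate to the counts from its children, and those of sibling subtrees have disjoint
  supports.\<close>

lemma trace_add_downs:
  defines "c \<equiv> \<lambda>xs l. length (filter (\<lambda>x. fst x > 0 \<and> certificate x = l) xs)"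
  shows "wf_at p t \<Longrightarrow> trace p t = add_downs (c (inner p k t)) k (bare_trace t)"
    and "\<forall>t\<in>set ts. wf_at p t \<Longrightarrow> concat (map (\<lambda>t. Rise # trace p t) ts) =
      add_downs (c (inner_list p k ts)) k (concat (map (\<lambda>t. Rise # bare_trace t) ts))"
proof (induction p k t and p k ts rule: inner_inner_list.induct)
  case (1 p k a)
  then show ?case by (simp add: c_def)
next
  case (2 p k ts)
  let ?xs = "concat (map (\<lambda>t. Rise # trace (Suc p) t) ts)"
  have IH: "?xs = add_downs (c (inner_list (Suc p) k ts)) k (concat (map (\<lambda>t. Rise # bare_trace t) ts))"
    using 2 by simp
  have lab: "labels ?xs = leaves (Node ts)" by (simp add: labels_concat comp_def)
  show ?case
  proof (cases "p = 0")
    case True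
    have "-1 \<le> a" if "a \<in> set (labels ?xs)" for a
      using that wf_at_leaves[OF 2(2)] lab by simp
    then have "bump (int p - 2) ?xs = ?xs" using True by (intro bump_ident) force
    then show ?thesis using IH True by (simp add: c_def)
  next
    case False
    then have "\<exists>a\<in>set (labels ?xs). a \<le> int p - 2" using 2(2) unfolding lab by simp
    then have "bump (int p - 2) ?xs =
        add_downs (\<lambda>l. if l = certificate (p, k, ts) then 1 else 0) k ?xs"
      using bump_add_downs[of ?xs "int p - 2" k] lab by (simp add: certificate_def)
    also have "\<dots> = add_downs (c (inner p k (Node ts))) k (concat (map (\<lambda>t. Rise # bare_trace t) ts))"
      unfolding IH add_downs_add_downs by (rule add_downs_cong) (use False in \<open>simp add: c_def\<close>)
    finally show ?thesis by simp
  qed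
next
  case (3 p k)
  then show ?case by simp
next
  case (4 p k t ts)
  let ?k = "k + length (leaves t)"
  have r1: "certificate x < ?k" if "x \<in> set (inner p k t)" "fst x > 0" for x
    using certificate_inner_range(1)[of p t x k] 4(3) that by simp
  have r2: "?k \<le> certificate x" if "x \<in> set (inner_list p ?k ts)" "fst x > 0" for x
    using certificate_inner_range(2)[of ts p x ?k] 4(3) that by simp
  have c: "c (inner p k t @ inner_list p ?k ts) l = c (inner p k t) l + c (inner_list p ?k ts) l" for l
    by (simp add: c_def)
  have z1: "c (inner p k t) l = 0" if "?k \<le> l" for l
    using r1 that by (fastforce simp: c_def filter_empty_conv)
  have z2: "c (inner_list p ?k ts) l = 0" if "l < ?k" for l
    using r2 that by (fastforce simp: c_def filter_empty_conv)
  have "trace p t = add_downs (c (inner_list p k (t # ts))) k (bare_trace t)"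
    using 4(1,3) by (auto simp: c z2 intro!: add_downs_cong)
  moreover have "concat (map (\<lambda>t. Rise # trace p t) ts) =
      add_downs (c (inner_list p k (t # ts))) ?k (concat (map (\<lambda>t. Rise # bare_trace t) ts))"
    using 4(2,3) by (auto simp: c z1 intro!: add_downs_cong)
  ultimately show ?case by (simp add: add_downs_append)
qed

lemma P_path_trace: "decorated T \<Longrightarrow> P_path T = path_of (trace 0 T)"
  using trace_add_downs(1)[of 0 T 0]
  by (simp add: decorated_iff P_path_def P_word_add_downs(1) cert_count_def[abs_def])

section \<open>Operations on decorated trees\<close>

lemma guarded_append:
  "guarded p (xs @ ys) \<longleftrightarrow> guarded p xs \<and> guarded p ys \<and> (p \<in> set ys \<longrightarrow> (\<forall>x\<in>set xs. p \<le> x))"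
proof (intro iffI conjI impI)
  assume g: "guarded p (xs @ ys)"
  show "guarded p xs" unfolding guarded_def
  proof (intro allI impI)
    fix us vs assume "xs = us @ p # vs"
    then have "xs @ ys = us @ p # (vs @ ys)" by simp
    then show "\<forall>y\<in>set us. p \<le> y" using g unfolding guarded_def by blast
  qed
  show "guarded p ys" unfolding guarded_def
  proof (intro allI impI)
    fix us vs assume "ys = us @ p # vs"
    then have "xs @ ys = (xs @ us) @ p # vs" by simp
    then have "\<forall>y\<in>set (xs @ us). p \<le> y" using g unfolding guarded_def by blast
    then show "\<forall>y\<in>set us. p \<le> y" by simp
  qed
  assume "p \<in> set ys"
  then obtain us vs where "ys = us @ p # vs" by (auto dest: split_list)
  then have "xs @ ys = (xs @ us) @ p # vs" by simp
  then have "\<forall>y\<in>set (xs @ us). p \<le> y" using g unfolding guarded_def by blast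
  then show "\<forall>x\<in>set xs. p \<le> x" by simp
next
  assume g: "guarded p xs \<and> guarded p ys \<and> (p \<in> set ys \<longrightarrow> (\<forall>x\<in>set xs. p \<le> x))"
  show "guarded p (xs @ ys)" unfolding guarded_def
  proof (intro allI impI)
    fix us vs assume eq: "xs @ ys = us @ p # vs"
    then consider ws where "xs = us @ p # ws" | ws where "us = xs @ ws" "ys = ws @ p # vs"
      unfolding append_eq_append_conv2 by (auto simp: append_eq_Cons_conv)
    then show "\<forall>y\<in>set us. p \<le> y"
    proof cases
      case 1
      then show ?thesis using g unfolding guarded_def by blast
    next
      case 2
      have "p \<in> set ys" using 2(2) by simp
      then show ?thesis using g 2 unfolding guarded_def by auto
    qed
  qed
qed

lemma guarded_singleton [simp]: "guarded p [x]"
  by (simp add: guarded_nth)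

lemma guarded_map:
  assumes "\<And>x. x \<in> set xs \<Longrightarrow> f x = q \<Longrightarrow> x = p"
    and "\<And>x. x \<in> set xs \<Longrightarrow> p \<le> x \<Longrightarrow> q \<le> f x"
    and "guarded p xs"
  shows "guarded q (map f xs)"
  unfolding guarded_nth
proof (intro allI impI)
  fix i j assume *: "i < length (map f xs)" "map f xs ! i = q" "j < i"
  then have "xs ! i = p" using assms(1) by simp
  then have "p \<le> xs ! j" using * assms(3) by (simp add: guarded_nth)
  then show "q \<le> map f xs ! j" using * assms(2) by simp
qed

lemma bump_append1:
  "(\<exists>a\<in>set (labels xs). a \<le> m) \<or> (\<forall>a\<in>set (labels ys). m < a) \<Longrightarrow> bump m (xs @ ys) = bump m xs @ ys"
  by (induction m xs rule: bump.induct) (force intro: bump_ident)+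

lemma bump_append2:
  "\<forall>a\<in>set (labels xs). m < a \<Longrightarrow> bump m (xs @ ys) = xs @ bump m ys"
  by (induction m xs rule: bump.induct) auto

lemma path_of_relabel [simp]: "path_of (map (map_token f) xs) = path_of xs"
  by (induction xs rule: path_of.induct) auto

lemma labels_relabel [simp]: "labels (map (map_token f) xs) = map f (labels xs)"
  by (induction xs rule: labels.induct) auto

lemma bump_relabel:
  "(\<And>a. a \<in> set (labels xs) \<Longrightarrow> f a \<le> m' \<longleftrightarrow> a \<le> m) \<Longrightarrow>
    bump m' (map (map_token f) xs) = map (map_token f) (bump m xs)"
  by (induction m xs rule: bump.induct) auto

lemma leaves_map_ltree [simp]: "leaves (map_ltree f t) = map f (leaves t)"
  by (induction t) (simp_all add: map_concat comp_def cong: map_cong)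

text \<open>Labels enter a trace only through comparisons with the thresholds of nodes;
  \<open>n\<close> runs over the depths below the root of \<open>t\<close>.\<close>

lemma trace_relabel:
  assumes "\<And>n a. a \<in> set (leaves t) \<Longrightarrow> f a \<le> int (q + n) - 2 \<longleftrightarrow> a \<le> int (p + n) - 2"
  shows "trace q (map_ltree f t) = map (map_token f) (trace p t)"
  using assms
proof (induction p t arbitrary: q rule: trace.induct)
  case (2 p ts)
  have "trace (Suc q) (map_ltree f t) = map (map_token f) (trace (Suc p) t)" if "t \<in> set ts" for t
  proof (rule 2(1)[OF that])
    fix n a assume "a \<in> set (leaves t)"
    then show "f a \<le> int (Suc q + n) - 2 \<longleftrightarrow> a \<le> int (Suc p + n) - 2"
      using that 2(2)[of a "Suc n"] by auto
  qed
  then have "concat (map (\<lambda>t. Rise # trace (Suc q) t) (map (map_ltree f) ts)) =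
      map (map_token f) (concat (map (\<lambda>t. Rise # trace (Suc p) t) ts))"
    by (simp add: map_concat comp_def cong: map_cong)
  moreover have "bump (int q - 2) (map (map_token f) (concat (map (\<lambda>t. Rise # trace (Suc p) t) ts))) =
      map (map_token f) (bump (int p - 2) (concat (map (\<lambda>t. Rise # trace (Suc p) t) ts)))"
    by (rule bump_relabel) (use 2(2)[of _ 0] in \<open>simp add: labels_concat comp_def\<close>)
  ultimately show ?case by simp
qed simp

text \<open>Induction along the rightmost path, where \<open>attach\<close>, \<open>graft\<close>
  and \<open>shift\<close> act; \<open>wf_at\<close> supplies the last child.\<close>

lemma rightmost_induct [consumes 1, case_names leaf node]:
  assumes "wf_at p t" "\<And>p a. wf_at p (Leaf a) \<Longrightarrow> P p (Leaf a)"
    "\<And>p ts t. wf_at p (Node (ts @ [t])) \<Longrightarrow> wf_at (Suc p) t \<Longrightarrow> P (Suc p) t \<Longrightarrow> P p (Node (ts @ [t]))"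
  shows "P p t"
  using assms(1)
proof (induction t arbitrary: p)
  case (Leaf a)
  then show ?case using assms(2) by simp
next
  case (Node us)
  then obtain ts t where us: "us = ts @ [t]" by (metis rev_exhaust wf_at.simps(2))
  have "wf_at (Suc p) t" using Node(2) us by simp
  then show ?case using Node us assms(3) by simp
qed

section \<open>Attaching, grafting and shifting on the rightmost path\<close>

lemma rpath_shift [simp]: "rpath (shift r t) = rpath t"
  by (induction r t rule: shift.induct) auto

lemma rpath_graft: "wf_at p t \<Longrightarrow> rpath (graft s t) = rpath t + rpath s"
  by (induction rule: rightmost_induct) auto

lemma rpath_attach: "wf_at p t \<Longrightarrow> 1 \<le> i \<Longrightarrow> i \<le> rpath t \<Longrightarrow> rpath (attach i t) = i"
  by (induction arbitrary: i rule: rightmost_induct) auto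

lemma leaves_attach: "wf_at p t \<Longrightarrow> 1 \<le> i \<Longrightarrow> i \<le> rpath t \<Longrightarrow> leaves (attach i t) = leaves t @ [-1]"
  by (induction arbitrary: i rule: rightmost_induct) auto

lemma leaves_graft: "wf_at p t \<Longrightarrow> leaves (graft s t) = butlast (leaves t) @ leaves s"
proof (induction rule: rightmost_induct)
  case (node p ts t)
  then show ?case using leaves_ne[OF node(2)] by (simp add: butlast_append)
qed simp

lemma leaves_shift:
  "wf_at p t \<Longrightarrow> leaves (shift r t) = map (\<lambda>a. a + r) (butlast (leaves t)) @ [last (leaves t)]"
proof (induction rule: rightmost_induct)
  case (node p ts t)
  then show ?case using leaves_ne[OF node(2)] by (simp add: butlast_append map_concat comp_def)
qed simp

text \<open>After the last leaf only the ascent along the rightmost path remains; \<open>X\<close>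
  is the part before it and is independent of \<open>s\<close>. That \<open>X\<close> ends in
  \<open>Up\<close> identifies the final run of down steps, as \<open>mir_append\<close>
  requires.\<close>

lemma Q_path_graft:
  "wf_at p t \<Longrightarrow> \<exists>X. Q_path t = X @ replicate (rpath t) Down \<and> (rpath t > 0 \<longrightarrow> X \<noteq> [] \<and> last X = Up) \<and>
    (\<forall>s. Q_path (graft s t) = X @ Q_path s @ replicate (rpath t) Down)"
proof (induction rule: rightmost_induct)
  case (node p ts t)
  then obtain X where X: "Q_path t = X @ replicate (rpath t) Down" "rpath t > 0 \<longrightarrow> X \<noteq> [] \<and> last X = Up"
    "\<And>s. Q_path (graft s t) = X @ Q_path s @ replicate (rpath t) Down" by metis
  have "X = []" if "rpath t = 0"
    using that node(2) X(1) by (cases t) (auto split: if_splits)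
  then show ?case using X
    by (intro exI[of _ "Q_path (Node ts) @ Up # X"]) (auto simp: replicate_append_same)
qed simp

text \<open>From the last leaf back to the \<open>i\<close>-th node there are
  \<open>Suc (rpath t) - i\<close> edges, and \<open>i - 1\<close> more lead to the root.\<close>

lemma Q_path_attach:
  "wf_at p t \<Longrightarrow> 1 \<le> i \<Longrightarrow> i \<le> rpath t \<Longrightarrow> \<exists>X. Q_path t = X @ replicate (rpath t) Down \<and>
    Q_path (attach i t) = X @ replicate (Suc (rpath t) - i) Down @ [Up, Down] @ replicate (i - 1) Down"
proof (induction arbitrary: i rule: rightmost_induct)
  case (node p ts t)
  show ?case
  proof (cases "i = 1")
    case True
    obtain X where X: "Q_path t = X @ replicate (rpath t) Down"
      using Q_path_graft[OF node(2)] by blast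
    show ?thesis using True X
      by (intro exI[of _ "Q_path (Node ts) @ Up # X"]) (auto simp: replicate_append_same)
  next
    case False
    then have i: "1 \<le> i - 1" "i - 1 \<le> rpath t" using node(4,5) by auto
    from node(3)[OF this] obtain X where X: "Q_path t = X @ replicate (rpath t) Down"
      "Q_path (attach (i - 1) t) =
        X @ replicate (Suc (rpath t) - (i - 1)) Down @ [Up, Down] @ replicate (i - 1 - 1) Down"
      by blast
    have "replicate (i - Suc 0) Down = replicate (i - 1 - 1) Down @ [Down]"
      using i(1) by (cases "i - 1") (auto simp: replicate_append_same)
    moreover have "Suc (Suc (rpath t)) - i = Suc (rpath t) - (i - 1)" using i by simp
    ultimately show ?thesis using X False node(4)
      by (intro exI[of _ "Q_path (Node ts) @ Up # X"]) (auto simp: replicate_append_same)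
  qed
qed simp

text \<open>No certificate changes: nodes at positive depth already have one before the new last
  leaf, and at depth 0 the threshold -2 excludes the label -1.\<close>

lemma trace_attach:
  "wf_at p t \<Longrightarrow> 1 \<le> i \<Longrightarrow> i \<le> rpath t \<Longrightarrow> trace p (attach i t) = trace p t @ [Rise, Tip (-1) 1]"
proof (induction arbitrary: i rule: rightmost_induct)
  case (node p ts t)
  let ?ys = "concat (map (\<lambda>t. Rise # trace (Suc p) t) ts) @ Rise # trace (Suc p) t"
  have "(\<exists>a\<in>set (labels ?ys). a \<le> int p - 2) \<or> p = 0"
    using node(1) by (auto simp: labels_concat)
  then have *: "bump (int p - 2) (?ys @ [Rise, Tip (-1) 1]) = bump (int p - 2) ?ys @ [Rise, Tip (-1) 1]"
    by (intro bump_append1) auto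
  show ?case
  proof (cases "i = 1")
    case True
    then show ?thesis using * by simp
  next
    case False
    then have "1 \<le> i - 1" "i - 1 \<le> rpath t" using node(4,5) by auto
    from node(3)[OF this] show ?thesis using * False node(4) by simp
  qed
qed simp

lemma wf_attach: "wf_at p t \<Longrightarrow> 1 \<le> i \<Longrightarrow> i \<le> rpath t \<Longrightarrow> wf_at p (attach i t)"
proof (induction arbitrary: i rule: rightmost_induct)
  case (node p ts t)
  show ?case
  proof (cases "i = 1")
    case True
    then show ?thesis using node(1) by auto
  next
    case False
    then have "1 \<le> i - 1" "i - 1 \<le> rpath t" using node(4,5) by auto
    with node False show ?thesis by (auto simp: leaves_attach guarded_append)
  qed
qed simp

text \<open>The edge into \<open>t\<close> is prepended so that a lone leaf has the same form; a
  bump alters only a number of down steps.\<close>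

lemma trace_Rise_snoc:
  "wf_at p t \<Longrightarrow> \<exists>xs d. Rise # trace p t = xs @ [Rise, Tip (last (leaves t)) (Suc d)]"
proof (induction rule: rightmost_induct)
  case (leaf p a)
  show ?case by (intro exI[of _ "[]"] exI[of _ 0]) simp
next
  case (node p ts t)
  then obtain xs d where xs: "Rise # trace (Suc p) t = xs @ [Rise, Tip (last (leaves t)) (Suc d)]" by blast
  have "\<exists>xs' d'. bump m (xs @ [Rise, Tip a (Suc d)]) = xs' @ [Rise, Tip a (Suc d')]" for m xs a d
    by (induction m xs rule: bump.induct) (auto intro: exI[of _ "[]"] exI[of _ "_ # _"])
  from this[of "int p - 2" "concat (map (\<lambda>t. Rise # trace (Suc p) t) ts) @ xs" "last (leaves t)" d]
  obtain xs' d' where "trace p (Node (ts @ [t])) = xs' @ [Rise, Tip (last (leaves t)) (Suc d')]"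
    using xs by auto
  then show ?case using leaves_ne[OF node(2)] by (intro exI[of _ "Rise # xs'"] exI[of _ d']) simp
qed

lemma trace_snoc:
  assumes "wf_at p t"
  shows "\<exists>xs d. trace p t = xs @ [Tip (last (leaves t)) (Suc d)]"
proof -
  obtain xs d where "Rise # trace p t = xs @ [Rise, Tip (last (leaves t)) (Suc d)]"
    using trace_Rise_snoc[OF assms] by blast
  then show ?thesis by (cases xs) (auto intro: exI[of _ "_ @ [Rise]"])
qed

text \<open>Internal nodes on the rightmost path of \<open>t\<close> have thresholds at most
  \<open>p + rpath t - 3\<close>, below all labels in \<open>ys\<close>, so those certified by the
  removed leaf pass to the last leaf of \<open>s\<close>. The down step that every leaf contributes
  for itself is counted once, hence \<open>d + e\<close> and not \<open>d + Suc e\<close>.\<close>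

lemma trace_graft:
  assumes "wf_at p t" "trace p t = xs @ [Tip (-1) d]"
    and "trace (p + rpath t) s = ys @ [Tip (-1) (Suc e)]"
    and "\<And>a. a \<in> set (labels ys) \<Longrightarrow> int (p + rpath t) - 1 \<le> a"
  shows "trace p (graft s t) = xs @ ys @ [Tip (-1) (d + e)]"
  using assms
proof (induction arbitrary: xs d rule: rightmost_induct)
  case (node p ts t)
  obtain xs' d' where t: "trace (Suc p) t = xs' @ [Tip (last (leaves t)) d']"
    using trace_snoc[OF node(2)] by blast
  have "last (labels (trace p (Node (ts @ [t])))) = -1" using node(4) by (simp del: trace.simps labels_trace)
  then have "last (leaves t) = -1" using leaves_ne[OF node(2)] by (simp del: trace.simps)
  note t = t[unfolded this]
  have g: "trace (Suc p) (graft s t) = xs' @ ys @ [Tip (-1) (d' + e)]"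
    using node(3)[OF t] node(5,6) by simp
  let ?B = "concat (map (\<lambda>t. Rise # trace (Suc p) t) ts) @ Rise # xs'" and ?m = "int p - 2"
  have 1: "trace p (Node (ts @ [t])) = bump ?m (?B @ [Tip (-1) d'])" using t by simp
  have 2: "trace p (graft s (Node (ts @ [t]))) = bump ?m (?B @ ys @ [Tip (-1) (d' + e)])" using g by simp
  show ?case
  \<comment> \<open>Either the certificate of this node precedes the last leaf of \<open>t\<close>,
    or the bump runs through to that leaf.\<close>
  proof (cases "\<exists>a\<in>set (labels ?B). a \<le> ?m")
    case True
    then have "bump ?m (?B @ zs) = bump ?m ?B @ zs" for zs by (intro bump_append1) blast
    then show ?thesis using 1 2 node(4) by (simp only:) auto
  next
    case False
    then have B: "\<forall>a\<in>set (labels ?B). ?m < a" by (meson not_le)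
    have ys: "\<forall>a\<in>set (labels ys). ?m < a" using node(6) by force
    show ?thesis using 1 2 node(4) unfolding bump_append2[OF B] bump_append2[OF ys]
      by (auto split: if_splits)
  qed
qed simp


text \<open>Depths and labels grow together, so comparisons persist. The unshifted label -1 is at
  most \<open>p - 2\<close> for \<open>p > 0\<close>, so the last leaf is eligible before and
  after.\<close>

lemma trace_shift:
  assumes "wf_at p t" "trace p t = xs @ [Tip (-1) d]" "p > 0"
  shows "trace (p + r) (shift (int r) t) = map (map_token (\<lambda>a. a + int r)) xs @ [Tip (-1) d]"
  using assms
proof (induction arbitrary: xs d rule: rightmost_induct)
  case (node p ts t)
  let ?f = "\<lambda>a. a + int r"
  obtain xs' d' where t: "trace (Suc p) t = xs' @ [Tip (last (leaves t)) d']"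
    using trace_snoc[OF node(2)] by blast
  have "last (labels (trace p (Node (ts @ [t])))) = -1" using node(4) by (simp del: trace.simps labels_trace)
  then have "last (leaves t) = -1" using leaves_ne[OF node(2)] by (simp del: trace.simps)
  note t = t[unfolded this]
  have s: "trace (Suc (p + r)) (shift (int r) t) = map (map_token ?f) xs' @ [Tip (-1) d']"
    using node(3)[OF t] by simp
  have m: "trace (Suc (p + r)) (map_ltree ?f u) = map (map_token ?f) (trace (Suc p) u)" for u
    by (rule trace_relabel) auto
  let ?B = "concat (map (\<lambda>t. Rise # trace (Suc p) t) ts) @ Rise # xs'" and ?m = "int p - 2"
  have 1: "trace p (Node (ts @ [t])) = bump ?m (?B @ [Tip (-1) d'])" using t by simp
  have 2: "trace (p + r) (shift (int r) (Node (ts @ [t]))) =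
      bump (int (p + r) - 2) (map (map_token ?f) ?B @ [Tip (-1) d'])"
    using s by (simp add: m comp_def map_concat)
  have 3: "bump (int (p + r) - 2) (map (map_token ?f) ?B) = map (map_token ?f) (bump ?m ?B)"
    by (rule bump_relabel) auto
  show ?case
  proof (cases "\<exists>a\<in>set (labels ?B). a \<le> ?m")
    case True
    then obtain a where a: "a \<in> set (labels ?B)" "a \<le> ?m" by blast
    then have "?f a \<in> set (labels (map (map_token ?f) ?B))" "?f a \<le> int (p + r) - 2"
      unfolding labels_relabel by (simp_all only: set_map imageI) simp
    then have "bump (int (p + r) - 2) (map (map_token ?f) ?B @ [Tip (-1) d']) =
        bump (int (p + r) - 2) (map (map_token ?f) ?B) @ [Tip (-1) d']"
      by (intro bump_append1) blast
    moreover have "bump ?m (?B @ [Tip (-1) d']) = bump ?m ?B @ [Tip (-1) d']"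
      using a by (intro bump_append1) blast
    ultimately show ?thesis using 1 2 3 node(4) by simp
  next
    case False
    then have B: "\<forall>a\<in>set (labels ?B). ?m < a" by (meson not_le)
    then have B': "\<forall>a\<in>set (labels (map (map_token ?f) ?B)). int (p + r) - 2 < a" by auto
    show ?thesis using 1 2 node(4,5) unfolding bump_append2[OF B] bump_append2[OF B']
      by (auto split: if_splits)
  qed
qed simp

text \<open>The former root sits at depth \<open>r > 0\<close> and acquires a certificate. Shifted
  labels are at least \<open>r - 1\<close>, so it is the last leaf, which gains a down step.\<close>

lemma trace_shift_root:
  assumes "wf_at 0 (Node us)" "trace 0 (Node us) = xs @ [Tip (-1) d]" "r > 0"
  shows "trace r (shift (int r) (Node us)) = map (map_token (\<lambda>a. a + int r)) xs @ [Tip (-1) (Suc d)]"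
proof -
  obtain ts t where us: "us = ts @ [t]" using assms(1) by (metis rev_exhaust wf_at.simps(2))
  let ?f = "\<lambda>a. a + int r"
  have wf: "wf_at (Suc 0) t" using assms(1) us by simp
  obtain xs' d' where t: "trace (Suc 0) t = xs' @ [Tip (last (leaves t)) d']"
    using trace_snoc[OF wf] by blast
  have "last (labels (trace 0 (Node (ts @ [t])))) = -1"
    using assms(2) us by (simp del: trace.simps labels_trace)
  then have l: "last (leaves t) = -1" using leaves_ne[OF wf] by (simp del: trace.simps)
  note t = t[unfolded this]
  have s: "trace (Suc r) (shift (int r) t) = map (map_token ?f) xs' @ [Tip (-1) d']"
    using trace_shift[OF wf t] by simp
  have m: "trace (Suc r) (map_ltree ?f u) = map (map_token ?f) (trace (Suc 0) u)" for u
    by (rule trace_relabel) auto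
  let ?B = "concat (map (\<lambda>t. Rise # trace (Suc 0) t) ts) @ Rise # xs'"
  have lab: "labels (?B @ [Tip (-1) d']) = leaves (Node us)"
    using arg_cong[OF t, of labels] by (simp add: us labels_concat comp_def)
  have L: "-1 \<le> a" if "a \<in> set (labels (?B @ [Tip (-1) d']))" for a
    using wf_at_leaves[OF assms(1)] that unfolding lab .
  have "trace 0 (Node us) = bump (-2) (?B @ [Tip (-1) d'])" using t us by simp
  also have "\<dots> = ?B @ [Tip (-1) d']"
    by (rule bump_ident, drule L) simp
  finally have xs: "xs = ?B" "d = d'" using assms(2) by simp_all
  have B': "\<forall>a\<in>set (labels (map (map_token ?f) ?B)). int r - 2 < a"
    using L by fastforce
  have "trace r (shift (int r) (Node us)) = bump (int r - 2) (map (map_token ?f) ?B @ [Tip (-1) d'])"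
    using s by (simp add: us m comp_def map_concat)
  then show ?thesis using assms(3) xs unfolding bump_append2[OF B'] by simp
qed

section \<open>Tree conditions under shifting, grafting and root deletion\<close>

lemma wf_map_add:
  "wf_at p t \<Longrightarrow> p > 0 \<Longrightarrow> wf_at (p + r) (map_ltree (\<lambda>a. a + int r) t)"
proof (induction p t rule: wf_at.induct)
  case (2 p ts)
  have "\<exists>t\<in>set ts. \<exists>a\<in>set (leaves t). a + int r \<le> int (p + r) - 2" using 2(2,3) by auto
  moreover have "guarded (int (p + r)) (map (\<lambda>a. a + int r) (leaves t))" if "t \<in> set ts" for t
    by (rule guarded_map[where p = "int p"]) (use 2(2) that in auto)
  ultimately show ?case using 2 by auto
qed simp

lemma wf_shift:
  "wf_at p t \<Longrightarrow> last (leaves t) = -1 \<Longrightarrow> wf_at (p + r) (shift (int r) t)"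
proof (induction rule: rightmost_induct)
  case (node p ts t)
  let ?f = "\<lambda>a. a + int r"
  have ne: "leaves t \<noteq> []" using leaves_ne[OF node(2)] .
  then have l: "last (leaves t) = -1" using node(4) by simp
  obtain ls where ls: "leaves t = ls @ [-1]" using ne l by (metis append_butlast_last_id)
  have lt: "leaves (shift (int r) t) = map ?f ls @ [-1]"
    using leaves_shift[OF node(2)] ls by simp
  have "guarded (int p) ls" using node(1) ls by (simp add: guarded_append)
  then have "guarded (int (p + r)) (map ?f ls)" by (rule guarded_map[rotated 2]) auto
  then have "guarded (int (p + r)) (leaves (shift (int r) t))" by (simp add: lt guarded_append)
  moreover have "guarded (int (p + r)) (map ?f (leaves u))" if "u \<in> set ts" for u
    by (rule guarded_map[where p = "int p"]) (use node(1) that in auto)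
  moreover have "\<exists>u\<in>set (map (map_ltree ?f) ts @ [shift (int r) t]). \<exists>a\<in>set (leaves u). a \<le> int (p + r) - 2"
    if "p + r > 0"
  proof (cases "r > 0")
    \<comment> \<open>Here the depth is at least 1, so the unshifted free leaf satisfies condition
      (2), even for a node that was the root.\<close>
    case True
    then show ?thesis using lt by auto
  next
    case False
    then have "p > 0" using that by simp
    then obtain u a where u: "u \<in> set (ts @ [t])" "a \<in> set (leaves u)" "a \<le> int p - 2" using node(1) by auto
    have "leaves (shift (int r) t) = leaves t" using False lt ls by simp
    then show ?thesis using u False by auto
  qed
  moreover have "wf_at (Suc (p + r)) (map_ltree ?f u)" if "u \<in> set ts" for u
    using wf_map_add[of "Suc p" u r] node(1) that by simp
  moreover have "wf_at (Suc (p + r)) (shift (int r) t)" using node(3) l by simp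
  ultimately show ?case by auto
qed simp

lemma wf_graft:
  assumes "wf_at p t" "last (leaves t) = -1" "wf_at (p + rpath t) s" "leaves s = ls @ [-1]"
    and "\<And>a. a \<in> set ls \<Longrightarrow> int (p + rpath t) - 1 \<le> a"
  shows "wf_at p (graft s t)"
  using assms
proof (induction rule: rightmost_induct)
  case (node p ts t)
  have ne: "leaves t \<noteq> []" using leaves_ne[OF node(2)] .
  then have l: "last (leaves t) = -1" using node(4) by simp
  obtain ks where ks: "leaves t = ks @ [-1]" using ne l by (metis append_butlast_last_id)
  have lg: "leaves (graft s t) = ks @ ls @ [-1]" using leaves_graft[OF node(2)] ks node(6) by simp
  have "wf_at (Suc p) (graft s t)" using node(3)[OF l] node(5,6,7) by simp
  moreover have "guarded (int p) (leaves (graft s t))"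
  proof -
    have "guarded (int p) ks" using node(1) ks by (simp add: guarded_append)
    moreover have "guarded (int p) ls" unfolding guarded_def using node(7) by force
    \<comment> \<open>A label \<open>p\<close> in \<open>ls\<close> forces \<open>t\<close> to be a
      single leaf by the lower bound, so nothing from \<open>t\<close> precedes
      \<open>ls\<close>.\<close>
    moreover have "ks = []" if "int p \<in> set ls"
    proof -
      have "rpath t = 0" using node(7)[OF that] by simp
      then show ?thesis using node(2) ks by (cases t) auto
    qed
    ultimately show ?thesis by (auto simp: lg guarded_append)
  qed
  moreover have "\<exists>u\<in>set (ts @ [graft s t]). \<exists>a\<in>set (leaves u). a \<le> int p - 2" if p: "p > 0"
  proof -
    obtain u a where u: "u \<in> set (ts @ [t])" "a \<in> set (leaves u)" "a \<le> int p - 2"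
      using node(1) p by auto
    show ?thesis
    proof (cases "u \<in> set ts")
      \<comment> \<open>If the witness was the removed leaf, the last leaf of the graft, also
        labeled -1, replaces it.\<close>
      case False
      then have "a \<in> set (leaves (graft s t))" using u ks lg by auto
      then show ?thesis using u(3) by auto
    qed (use u in auto)
  qed
  ultimately show ?case using node(1) by auto
qed simp

text \<open>The relabelling merges only 0 with -1, and a value \<open>p\<close> arises from
  \<open>p + 1\<close> alone, so guards carry over. The exception is a leaf child of the root, which
  would become a tree without edges.\<close>

lemma wf_Pi_tree:
  "wf_at (Suc p) t \<Longrightarrow> wf_at p (Pi_tree t) \<or> (p = 0 \<and> (\<exists>a. t = Leaf a))"
proof (induction "Suc p" t arbitrary: p rule: wf_at.induct)
  case (2 ts)
  define f :: "int \<Rightarrow> int" where "f a = (if a = -1 then -1 else a - 1)" for a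
  have Pi: "Pi_tree = map_ltree f" by (simp add: Pi_tree_def[abs_def] f_def[abs_def])
  have ge: "-1 \<le> a" if "t \<in> set ts" "a \<in> set (leaves t)" for t a
    using wf_at_leaves[OF 2(2), of a] that by auto
  have "wf_at (Suc p) (map_ltree f t)" if "t \<in> set ts" for t
    using 2(1)[OF that] 2(2) that by (simp add: Pi)
  moreover have "guarded (int p) (map f (leaves t))" if "t \<in> set ts" for t
    by (rule guarded_map[where p = "int (Suc p)"])
      (use 2(2) that ge in \<open>auto simp: f_def split: if_splits\<close>)
  moreover have "\<exists>t\<in>set ts. \<exists>a\<in>set (leaves t). f a \<le> int p - 2" if p: "p > 0"
  proof -
    obtain t a where "t \<in> set ts" "a \<in> set (leaves t)" "a \<le> int (Suc p) - 2" using 2(2) by auto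
    then show ?thesis using p by (intro bexI[of _ t] bexI[of _ a]) (auto simp: f_def)
  qed
  ultimately show ?case using 2(2) by (auto simp: Pi)
qed (auto simp: Pi_tree_def)

text \<open>For \<open>p > 0\<close> free leaves are eligible at both thresholds, and other labels
  drop along with the depth. At depth 0 the new root loses its certificate;
  \<open>trace_single\<close> treats that case.\<close>

lemma trace_Pi_tree:
  assumes "wf_at (Suc p) t" "p > 0"
  shows "trace p (Pi_tree t) = map (map_token (\<lambda>a. if a = -1 then -1 else a - 1)) (trace (Suc p) t)"
  unfolding Pi_tree_def
  by (rule trace_relabel) (use wf_at_leaves[OF assms(1)] assms(2) in force)

section \<open>Returns of the lower path and the mirror of a concatenation\<close>

lemma dyck_Nil [simp]: "dyck []"
  by (simp add: dyck_def)

lemma dyck_append: "dyck v \<Longrightarrow> dyck w \<Longrightarrow> dyck (v @ w)"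
  unfolding dyck_def
proof (intro conjI allI impI)
  fix k
  assume v: "count_list v Up = count_list v Down \<and>
      (\<forall>k\<le>length v. count_list (take k v) Down \<le> count_list (take k v) Up)"
    and w: "count_list w Up = count_list w Down \<and>
      (\<forall>k\<le>length w. count_list (take k w) Down \<le> count_list (take k w) Up)"
    and k: "k \<le> length (v @ w)"
  show "count_list (take k (v @ w)) Down \<le> count_list (take k (v @ w)) Up"
  proof (cases "k \<le> length v")
    case False
    then have "k - length v \<le> length w" using k by simp
    then show ?thesis using False v w by simp
  qed (use v in simp)
qed auto

text \<open>The nonempty Dyck paths that return to the axis only at their end.\<close>

definition prime_path :: "step list \<Rightarrow> bool" where
  "prime_path w \<longleftrightarrow> (\<exists>D. dyck D \<and> w = Up # D @ [Down])"

lemma dyck_prime: "prime_path w \<Longrightarrow> dyck w"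
  using dyck_compose[of "[]"] by (auto simp: prime_path_def)

lemma dyck_concat: "\<forall>r\<in>set rs. prime_path r \<Longrightarrow> dyck (concat rs)"
  by (induction rs) (auto intro: dyck_append dyck_prime)

lemma dyck_primes: "dyck w \<Longrightarrow> \<exists>rs. (\<forall>r\<in>set rs. prime_path r) \<and> w = concat rs"
proof (induction w rule: length_induct)
  case (1 w)
  show ?case
  proof (cases "w = []")
    case False
    then obtain D1 D2 where D: "dyck D1" "dyck D2" "w = D1 @ Up # D2 @ [Down]"
      using dyck_decomp_exists 1(2) by blast
    then obtain rs where "\<forall>r\<in>set rs. prime_path r" "D1 = concat rs" using 1(1) by force
    then show ?thesis using D(2,3)
      by (intro exI[of _ "rs @ [Up # D2 @ [Down]]"]) (auto simp: prime_path_def)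
  qed (auto intro: exI[of _ "[]"])
qed

lemma mir_prime: "dyck D \<Longrightarrow> mir (Up # D @ [Down]) = mir D @ [Up, Down]"
  using mir_decomp[of "[]" D] by (simp add: mir_Nil)

text \<open>Peeling off the last factor \<open>Up # D @ [Down]\<close> puts
  \<open>mir D @ [Up]\<close> in front and one \<open>Down\<close> behind; \<open>X\<close> collects
  the fronts. For empty \<open>A\<close>, the number of returns becomes the length of the final run
  of down steps.\<close>

lemma mir_concat:
  assumes "\<forall>r\<in>set rs. prime_path r"
  shows "\<exists>X. (rs \<noteq> [] \<longrightarrow> X \<noteq> [] \<and> last X = Up) \<and>
    (\<forall>A. dyck A \<longrightarrow> mir (A @ concat rs) = X @ mir A @ replicate (length rs) Down)"
  using assms
proof (induction rs rule: rev_induct)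
  case (snoc r rs)
  then obtain X where X: "rs \<noteq> [] \<longrightarrow> X \<noteq> [] \<and> last X = Up"
    "\<forall>A. dyck A \<longrightarrow> mir (A @ concat rs) = X @ mir A @ replicate (length rs) Down" by auto
  obtain D where D: "dyck D" "r = Up # D @ [Down]" using snoc(2) by (auto simp: prime_path_def)
  have "mir (A @ concat (rs @ [r])) = (mir D @ Up # X) @ mir A @ replicate (length (rs @ [r])) Down"
    if A: "dyck A" for A
  proof -
    have "dyck (A @ concat rs)" using A snoc(2) by (auto intro!: dyck_append dyck_concat)
    then have "mir ((A @ concat rs) @ Up # D @ [Down]) = mir D @ Up # mir (A @ concat rs) @ [Down]"
      using D(1) by (rule mir_decomp)
    then show ?thesis using X(2) A by (simp add: D(2) replicate_append_same)
  qed
  moreover have "X = []" if "rs = []" using X(2)[rule_format, of "[]"] that by (simp add: mir_Nil)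
  then have "last (mir D @ Up # X) = Up" using X(1) by (cases "X = []") auto
  ultimately show ?case by (intro exI[of _ "mir D @ Up # X"]) auto
qed auto

lemma append_replicate_Down_eq:
  assumes "X @ replicate m Down = Y @ replicate n Down" "X \<noteq> []" "last X = Up" "Y \<noteq> []" "last Y = Up"
  shows "X = Y \<and> m = n"
  using assms(1)
proof (induction m arbitrary: n)
  case 0
  show ?case
  proof (cases n)
    case (Suc k)
    then have "X = (Y @ replicate k Down) @ [Down]" using 0 by (simp add: replicate_append_same)
    then show ?thesis using assms(3) by simp
  qed (use 0 in simp)
next
  case (Suc m)
  show ?case
  proof (cases n)
    case 0
    then have "Y = (X @ replicate m Down) @ [Down]" using Suc.prems by (simp add: replicate_append_same)
    then show ?thesis using assms(5) by simp
  next
    case (Suc k)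
    then have "(X @ replicate m Down) @ [Down] = (Y @ replicate k Down) @ [Down]"
      using Suc.prems by (simp add: replicate_append_same)
    then show ?thesis using Suc.IH[of k] Suc by simp
  qed
qed

text \<open>Cutting \<open>mir B\<close> after its last up step determines \<open>X\<close> and
  \<open>m\<close>, so they agree with the pieces given by \<open>mir_concat\<close>.\<close>

lemma mir_append:
  assumes "dyck A" "dyck B" "mir B = X @ replicate m Down" "X \<noteq> []" "last X = Up"
  shows "mir (A @ B) = X @ mir A @ replicate m Down"
proof -
  obtain rs where rs: "\<forall>r\<in>set rs. prime_path r" "B = concat rs" using dyck_primes assms(2) by blast
  obtain Y where Y: "rs \<noteq> [] \<longrightarrow> Y \<noteq> [] \<and> last Y = Up"
    "\<And>A. dyck A \<Longrightarrow> mir (A @ concat rs) = Y @ mir A @ replicate (length rs) Down"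
    using mir_concat[OF rs(1)] by blast
  have "rs \<noteq> []" using rs(2) assms(3,4) by (auto simp: mir_Nil)
  moreover have B: "mir B = Y @ replicate (length rs) Down" using Y(2)[of "[]"] rs(2) by (simp add: mir_Nil)
  ultimately have "X = Y \<and> m = length rs"
    using Y(1) assms(3-5) by (intro append_replicate_Down_eq) auto
  then show ?thesis using Y(2)[OF assms(1)] rs(2) by simp
qed

lemma dyck_Q_path: "dyck (Q_path t)"
proof (induction t)
  case (Node ts)
  have "\<forall>r\<in>set (map (\<lambda>t. Up # Q_path t @ [Down]) ts). prime_path r"
    using Node by (auto simp: prime_path_def)
  from dyck_concat[OF this] show ?case by simp
qed simp

text \<open>The first returns of the lower path happen at the free leaves; a segment is the part of
  the traversal between two of them.\<close>

definition segment :: "int token list \<Rightarrow> bool" where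
  "segment xs \<longleftrightarrow> (\<exists>ys d. xs = ys @ [Tip (-1) d] \<and> -1 \<notin> set (labels ys)) \<and> prime_path (path_of xs)"

section \<open>Segments under deletion of the root\<close>

lemma count_segments: "\<forall>s\<in>set segs. segment s \<Longrightarrow> count_list (labels (concat segs)) (-1) = length segs"
  by (induction segs) (auto simp: segment_def count_notin)

lemma map_eq_concat:
  "map f zs = concat segs \<Longrightarrow> \<exists>zss. zs = concat zss \<and> segs = map (map f) zss"
proof (induction segs arbitrary: zs)
  case Nil
  then show ?case by (intro exI[of _ "[]"]) simp
next
  case (Cons s segs)
  then obtain xs ys where xy: "zs = xs @ ys" "s = map f xs" "concat segs = map f ys"
    by (auto simp: map_eq_append_conv)
  then obtain zss where "ys = concat zss" "segs = map (map f) zss" using Cons.IH[of ys] by metis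
  then show ?case using xy by (intro exI[of _ "xs # zss"]) simp
qed

lemma path_of_concat: "path_of (concat xss) = concat (map path_of xss)"
  by (induction xss) auto

text \<open>Segments of the traversal of \<open>Pi_tree (Node ts)\<close> end at labels that were -1
  or 0. The first -1 certifies the node of depth 1, and by condition (3) at the root no 0 follows
  it. So the segments up to it fuse into \<open>S\<close> and the later ones survive.\<close>

lemma trace_single:
  assumes wf: "wf_at 0 (Node [Node ts])"
    and segs: "trace 0 (Pi_tree (Node ts)) = concat segs" "\<forall>s\<in>set segs. segment s"
  shows "\<exists>Pl S segs'. path_of (trace 0 (Pi_tree (Node ts))) = Pl @ path_of (concat segs') \<and> dyck Pl \<and>
    path_of S = Up # Pl @ [Down] \<and> trace 0 (Node [Node ts]) = concat (S # segs') \<and>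
    (\<forall>s\<in>set (S # segs'). segment s)"
proof -
  define f :: "int \<Rightarrow> int" where "f a = (if a = -1 then -1 else a - 1)" for a
  have Pi: "Pi_tree t = map_ltree f t" for t by (simp add: Pi_tree_def f_def[abs_def])
  \<comment> \<open>\<open>Z\<close> is the traversal below the node of depth 1, before the
    certificate of that node receives its down step.\<close>
  define Z where "Z = concat (map (\<lambda>t. Rise # trace (Suc (Suc 0)) t) ts)"
  have lab: "labels Z = leaves (Node ts)" by (simp add: Z_def labels_concat comp_def)
  have ge: "-1 \<le> a" if "a \<in> set (labels Z)" for a
    using that wf_at_leaves[OF wf] lab by simp
  have wf': "wf_at 0 (Pi_tree (Node ts))" using wf wf_Pi_tree[of 0 "Node ts"] by simp
  have "trace (Suc 0) (Pi_tree t) = map (map_token f) (trace (Suc (Suc 0)) t)" if "t \<in> set ts" for t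
    using trace_Pi_tree[of "Suc 0" t] wf that by (simp add: f_def[abs_def])
  then have "concat (map (\<lambda>t. Rise # trace (Suc 0) t) (map (map_ltree f) ts)) = map (map_token f) Z"
    by (simp add: Z_def map_concat comp_def Pi cong: map_cong)
  moreover have "-1 \<le> f a" if "a \<in> set (labels Z)" for a using ge[OF that] by (simp add: f_def)
  then have "bump (-2) (map (map_token f) Z) = map (map_token f) Z" by (intro bump_ident) force
  ultimately have T': "trace 0 (Pi_tree (Node ts)) = map (map_token f) Z" by (simp add: Pi)
  then obtain zss where zss: "Z = concat zss" "segs = map (map (map_token f)) zss"
    using map_eq_concat segs(1) by metis
  have seg: "\<exists>ys a d. z = ys @ [Tip a d] \<and> a \<in> {-1, 0} \<and> -1 \<notin> set (labels ys) \<and> prime_path (path_of z)"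
    if "z \<in> set zss" for z
  proof -
    have "segment (map (map_token f) z)" using that segs(2) zss(2) by simp
    then obtain ys d where ys: "map (map_token f) z = ys @ [Tip (-1) d]" "-1 \<notin> set (labels ys)"
      and pr: "prime_path (path_of z)" by (auto simp: segment_def)
    then obtain us v where z: "z = us @ [v]" "ys = map (map_token f) us" "map_token f v = Tip (-1) d"
      by (auto simp: map_eq_append_conv)
    obtain a where v: "v = Tip a d" "f a = -1" using z(3) by (cases v) auto
    have "-1 \<notin> set (labels us)" using ys(2) z(2) by (force simp: f_def)
    moreover have "a \<in> {-1, 0}" using v(2) by (auto simp: f_def split: if_splits)
    ultimately show ?thesis using z(1) v(1) pr by blast
  qed
  obtain b where b: "b \<in> set (labels Z)" "b \<le> -1" using wf lab by auto
  then have "-1 \<in> set (labels Z)" using ge[OF b(1)] by simp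
  then have "\<exists>z\<in>set zss. -1 \<in> set (labels z)" by (auto simp: zss labels_concat)
  \<comment> \<open>\<open>z\<close> ends at the first leaf that is free in the original tree; the
    segments in \<open>za\<close> end at a 0.\<close>
  then obtain za z zb where split: "zss = za @ z # zb" "-1 \<in> set (labels z)"
    and za: "\<And>y. y \<in> set za \<Longrightarrow> -1 \<notin> set (labels y)"
    using split_list_first_prop[of zss "\<lambda>z. -1 \<in> set (labels z)"] by metis
  obtain ys d where z: "z = ys @ [Tip (-1) d]" "-1 \<notin> set (labels ys)"
    using seg[of z] split by fastforce
  have guard: "guarded 0 (labels Z)" using wf lab by simp
  have pr: "\<forall>y\<in>set zss. prime_path (path_of y)" using seg by blast
  have zb: "segment y" if y: "y \<in> set zb" for y
  proof -
    obtain us a e where us: "y = us @ [Tip a e]" "a \<in> {-1, 0}" "-1 \<notin> set (labels us)"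
      using seg[of y] split y by fastforce
    have "a \<noteq> 0"
    proof
      assume "a = 0"
      then have "0 \<in> set (labels (concat zb))" using us(1) y by (force simp: labels_concat)
      moreover have "labels Z = labels (concat za @ z) @ labels (concat zb)"
        by (simp add: zss split)
      ultimately have "\<forall>x\<in>set (labels (concat za @ z)). 0 \<le> x"
        using guard by (simp only: guarded_append) blast
      then show False using split(2) by force
    qed
    moreover have "prime_path (path_of y)" using pr split y by simp
    ultimately show ?thesis using us unfolding segment_def by blast
  qed
  have low: "-1 < a" if "a \<in> set (labels (concat za @ ys))" for a
  proof -
    have "a \<noteq> -1" using that za z(2) by (auto simp: labels_concat)
    moreover have "-1 \<le> a" by (rule ge) (use that in \<open>auto simp: zss split z labels_concat\<close>)
    ultimately show ?thesis by simp
  qed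
  define S where "S = Rise # concat za @ ys @ [Tip (-1) (Suc d)]"
  \<comment> \<open>The down step of the node of depth 1 falls on the last leaf of \<open>z\<close>;
    it matches the initial \<open>Rise\<close> of \<open>S\<close>.\<close>
  have "bump (-1) Z = (concat za @ ys) @ bump (-1) (Tip (-1) d # concat zb)"
    using bump_append2[of "concat za @ ys" "-1"] low by (simp add: zss split z)
  then have "trace 0 (Node [Node ts]) = bump (-2) (concat (S # zb))"
    by (simp add: Z_def[symmetric] S_def)
  moreover have "bump (-2) (concat (S # zb)) = concat (S # zb)"
  proof (rule bump_ident)
    fix a assume "a \<in> set (labels (concat (S # zb)))"
    then have "a \<in> set (labels Z)" by (auto simp: S_def zss split z)
    then show "-2 < a" using ge by force
  qed
  ultimately have T: "trace 0 (Node [Node ts]) = concat (S # zb)" by simp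
  define Pl where "Pl = path_of (concat za @ z)"
  have "dyck Pl" unfolding Pl_def path_of_append path_of_concat
    using dyck_concat[of "map path_of za @ [path_of z]"] pr split by simp
  moreover have S: "path_of S = Up # Pl @ [Down]"
    by (simp add: S_def Pl_def z replicate_append_same)
  moreover have "segment S" unfolding segment_def
  proof
    show "\<exists>ys d. S = ys @ [Tip (- 1) d] \<and> - 1 \<notin> set (labels ys)"
      using low by (intro exI[of _ "Rise # concat za @ ys"] exI[of _ "Suc d"]) (auto simp: S_def)
    show "prime_path (path_of S)" using S \<open>dyck Pl\<close> by (auto simp: prime_path_def)
  qed
  moreover have "path_of (trace 0 (Pi_tree (Node ts))) = Pl @ path_of (concat zb)"
    by (simp add: T' zss split Pl_def)
  ultimately show ?thesis using T zb by (intro exI[of _ Pl] exI[of _ S] exI[of _ zb]) auto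
qed

section \<open>The mirror theorem for trees\<close>

text \<open>Follows the recursion of \<open>h_tree\<close> with the two cases of several children
  merged: a leaf child of the root is free, so on its own it gives
  \<open>Node [Leaf (-1)]\<close>.\<close>

lemma decorated_induct [consumes 1, case_names edge single multi]:
  assumes "wf_at 0 T" "P (Node [Leaf (-1)])"
    and single: "\<And>ts. wf_at 0 (Node [Node ts]) \<Longrightarrow> wf_at 0 (Pi_tree (Node ts)) \<Longrightarrow>
      P (Pi_tree (Node ts)) \<Longrightarrow> P (Node [Node ts])"
    and multi: "\<And>t u us. wf_at 0 (Node [t]) \<Longrightarrow> wf_at 0 (Node (u # us)) \<Longrightarrow>
      P (Node [t]) \<Longrightarrow> P (Node (u # us)) \<Longrightarrow> P (Node (t # u # us))"
  shows "P T"
  using assms(1)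
proof (induction T rule: h_tree.induct)
  case (3 a)
  then have "a = -1" by auto
  then show ?case using assms(2) by simp
next
  case (4 ts)
  have "wf_at 0 (Pi_tree (Node ts))" using wf_Pi_tree[of 0 "Node ts"] 4(2) by simp
  then show ?case using 4 single by simp
next
  case (5 a t ts)
  have "a = -1" using 5(2) by auto
  then show ?case using 5 assms(2) multi[of "Leaf a" t ts] by auto
next
  case (6 ss t ts)
  then show ?case using multi[of "Node ss" t ts] by auto
qed auto

lemma trace_root:
  assumes "wf_at 0 (Node ts)"
  shows "trace 0 (Node ts) = concat (map (\<lambda>t. Rise # trace (Suc 0) t) ts)"
proof -
  have "-1 \<le> a" if "a \<in> set (labels (concat (map (\<lambda>t. Rise # trace (Suc 0) t) ts)))" for a
    by (rule wf_at_leaves[OF assms]) (use that in \<open>simp add: labels_concat comp_def\<close>)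
  then show ?thesis by simp (intro bump_ident, force)
qed

lemma trace_multi:
  assumes "wf_at 0 (Node ts)" "wf_at 0 (Node us)"
  shows "trace 0 (Node (ts @ us)) = trace 0 (Node ts) @ trace 0 (Node us)"
  using trace_root[OF assms(1)] trace_root[OF assms(2)] trace_root[of "ts @ us"] assms by auto

lemma segments:
  "wf_at 0 T \<Longrightarrow> \<exists>segs. trace 0 T = concat segs \<and> (\<forall>s\<in>set segs. segment s)"
proof (induction rule: decorated_induct)
  case edge
  have "segment [Rise, Tip (-1) 1]"
    unfolding segment_def prime_path_def
    by (auto intro!: exI[of _ "[Rise]"] exI[of _ 1] exI[of _ "[]"])
  then show ?case by (intro exI[of _ "[[Rise, Tip (-1) 1]]"]) simp
next
  case (single ts)
  then show ?case using trace_single by metis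
next
  case (multi t u us)
  then obtain ss ss' where "trace 0 (Node [t]) = concat ss" "\<forall>s\<in>set ss. segment s"
    "trace 0 (Node (u # us)) = concat ss'" "\<forall>s\<in>set ss'. segment s" by metis
  then show ?case using trace_multi[OF multi(1,2)]
    by (intro exI[of _ "ss @ ss'"]) (auto simp del: trace.simps)
qed

lemma dyck_trace:
  assumes "wf_at 0 T"
  shows "dyck (path_of (trace 0 T))"
proof -
  obtain segs where segs: "trace 0 T = concat segs" "\<forall>s\<in>set segs. segment s"
    using segments[OF assms] by blast
  then have "\<forall>r\<in>set (map path_of segs). prime_path r" by (auto simp: segment_def)
  from dyck_concat[OF this] show ?thesis by (simp add: segs(1) path_of_concat)
qed

text \<open>The last segment ends at a free leaf, so the last leaf of the tree is free. As the
  traversal starts with \<open>Rise\<close>, the one prepended in \<open>trace_Rise_snoc\<close> can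
  be removed.\<close>

lemma trace_root_snoc:
  assumes "wf_at 0 T"
  shows "\<exists>xs d. trace 0 T = xs @ [Rise, Tip (-1) (Suc d)]"
proof -
  obtain ts where T: "T = Node ts" using assms by (cases T) auto
  obtain segs where segs: "trace 0 T = concat segs" "\<forall>s\<in>set segs. segment s"
    using segments[OF assms] by blast
  obtain xs d where xs: "Rise # trace 0 T = xs @ [Rise, Tip (last (leaves T)) (Suc d)]"
    using trace_Rise_snoc[OF assms] by blast
  then have "segs \<noteq> []" using segs(1) by auto
  then obtain ss s where "segs = ss @ [s]" by (metis rev_exhaust)
  then have "\<exists>e. last (trace 0 T) = Tip (-1) e" using segs by (auto simp: segment_def)
  moreover have "trace 0 T \<noteq> []" using xs by (cases xs) auto
  then have "last (trace 0 T) = Tip (last (leaves T)) (Suc d)" using arg_cong[OF xs, of last] by simp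
  ultimately have l: "last (leaves T) = -1" by simp
  have "hd (trace 0 T) = Rise" using trace_root[of ts] assms T by (cases ts) auto
  then obtain xs' where "xs = Rise # xs'" using xs by (cases xs) auto
  then show ?thesis using xs l by auto
qed

lemma last_leaf: "wf_at 0 T \<Longrightarrow> \<exists>ls. leaves T = ls @ [-1]"
  using trace_root_snoc[of T] labels_trace[of 0 T]
  by (metis labels.simps labels_append)

lemma Q_path_map_ltree [simp]: "Q_path (map_ltree f t) = Q_path t"
  by (induction t) (simp_all add: comp_def cong: map_cong)

lemma Q_path_shift [simp]: "Q_path (shift r t) = Q_path t"
proof (induction r t rule: shift.induct)
  case (2 r ts)
  then show ?case
    by (cases ts rule: rev_cases) (simp_all add: comp_def)
qed simp

text \<open>If \<open>t\<close> is a leaf, \<open>h_tree\<close> fixes \<open>Node [t]\<close> and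
  the shift spares its only leaf, so both recursive cases take one form.\<close>

lemma h_tree_multi:
  assumes "wf_at 0 (Node [t])"
  shows "h_tree (Node (t # u # us)) =
    graft (shift (int (rpath (h_tree (Node (u # us))))) (h_tree (Node [t]))) (h_tree (Node (u # us)))"
proof (cases t)
  case (Leaf a)
  then have "a = -1" using assms by auto
  then show ?thesis using Leaf by simp
qed (simp add: Let_def)

text \<open>The equation for \<open>rpath\<close> is carried along because it ensures that
  \<open>attach\<close> acts at an internal node of the rightmost path.\<close>

lemma h_tree_mirror:
  assumes "wf_at 0 T"
  shows "wf_at 0 (h_tree T) \<and> rpath (h_tree T) = free_leaves T \<and>
    mir (path_of (trace 0 T)) = Q_path (h_tree T) \<and> mir (Q_path T) = path_of (trace 0 (h_tree T))"
  using assms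
proof (induction rule: decorated_induct)
  case edge
  show ?case using mir_prime[of "[]"] by (simp add: free_leaves_def mir_Nil)
next
  case (single ts)
  let ?T = "Node [Node ts]" and ?T' = "Pi_tree (Node ts)"
  let ?H = "h_tree ?T'"
  obtain segs where segs: "trace 0 ?T' = concat segs" "\<forall>s\<in>set segs. segment s"
    using segments[OF single(2)] by blast
  obtain Pl S segs' where P': "path_of (trace 0 ?T') = Pl @ path_of (concat segs')" and dPl: "dyck Pl"
    and S: "path_of S = Up # Pl @ [Down]" and T: "trace 0 ?T = concat (S # segs')"
    and seg: "\<forall>s\<in>set (S # segs'). segment s"
    using trace_single[OF single(1) segs] by metis
  define i where "i = free_leaves ?T"
  \<comment> \<open>Each segment has exactly one free leaf, so \<open>i - 1\<close> segments follow
    the first.\<close>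
  have i: "i = Suc (length segs')"
    using count_segments[OF seg] arg_cong[OF T, of labels]
    unfolding i_def free_leaves_def labels_trace by simp
  \<comment> \<open>Deleting the root keeps free leaves free and frees those labeled 0, which bounds
    \<open>i\<close> by \<open>rpath ?H\<close>.\<close>
  have "count_list xs (-1) \<le> count_list (map (\<lambda>a. if a = -1 then -1 else a - 1) xs) (-1)" for xs :: "int list"
    by (induction xs) auto
  from this[of "leaves (Node ts)"] have "i \<le> free_leaves ?T'"
    unfolding i_def free_leaves_def Pi_tree_def leaves_map_ltree by simp
  then have ir: "1 \<le> i" "i \<le> rpath ?H" using single(3) i by auto
  have wf: "wf_at 0 ?H" using single(3) by blast
  obtain Y where Y: "Q_path ?H = Y @ replicate (rpath ?H) Down"
    "Q_path (attach i ?H) = Y @ replicate (Suc (rpath ?H) - i) Down @ [Up, Down] @ replicate (i - 1) Down"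
    using Q_path_attach[OF wf ir] by blast
  define rs where "rs = map path_of segs'"
  have rs: "\<forall>r\<in>set rs. prime_path r" "length rs = i - 1" "path_of (concat segs') = concat rs"
    using seg i by (auto simp: rs_def segment_def path_of_concat)
  obtain X where X: "\<And>A. dyck A \<Longrightarrow> mir (A @ concat rs) = X @ mir A @ replicate (i - 1) Down"
    using mir_concat[OF rs(1)] rs(2) by auto
  \<comment> \<open>Two forms of \<open>Q_path ?H\<close>, from the rightmost path and from the
    mirror of \<open>Pl @ concat rs\<close>, are compared and the last \<open>i - 1\<close> down
    steps cancelled.\<close>
  have "rpath ?H = (Suc (rpath ?H) - i) + (i - 1)" using ir by simp
  then have "Y @ replicate (Suc (rpath ?H) - i) Down @ replicate (i - 1) Down = Q_path ?H"
    by (metis Y(1) replicate_add)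
  also have "\<dots> = X @ mir Pl @ replicate (i - 1) Down" using X[OF dPl] P' rs(3) single(3) by simp
  finally have XY: "Y @ replicate (Suc (rpath ?H) - i) Down = X @ mir Pl" by simp
  have "mir (path_of (trace 0 ?T)) = X @ mir (Up # Pl @ [Down]) @ replicate (i - 1) Down"
    using X[of "Up # Pl @ [Down]"] dyck_compose[of "[]" Pl] dPl S
    unfolding T by (simp add: rs(3))
  then have "mir (path_of (trace 0 ?T)) = Q_path (attach i ?H)"
    using XY unfolding Y(2) mir_prime[OF dPl] by (metis append.assoc)
  moreover have "Q_path (Node ts) = Q_path ?T'" by (simp only: Pi_tree_def Q_path_map_ltree)
  then have "mir (Q_path ?T) = path_of (trace 0 (attach i ?H))"
    using mir_prime[OF dyck_Q_path[of "Node ts"]] single(3) trace_attach[OF wf ir]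
    by (simp del: trace.simps)
  ultimately show ?case using wf_attach[OF wf ir] rpath_attach[OF wf ir] by (simp add: i_def del: trace.simps)
next
  case (multi t u us)
  let ?T1 = "Node [t]" and ?T2 = "Node (u # us)"
  let ?H1 = "h_tree ?T1" and ?H2 = "h_tree ?T2"
  define r where "r = rpath ?H2"
  let ?S = "shift (int r) ?H1"
  have wf: "wf_at 0 ?H1" "wf_at 0 ?H2" using multi by auto
  obtain hs where H1: "?H1 = Node hs" using wf(1) by (cases ?H1) auto
  have r: "r > 0" using wf(2) by (cases ?H2) (auto simp: r_def)
  have h: "h_tree (Node (t # u # us)) = graft ?S ?H2" using h_tree_multi[OF multi(1)] r_def by simp
  have T: "trace 0 (Node (t # u # us)) = trace 0 ?T1 @ trace 0 ?T2" using trace_multi[OF multi(1,2)] by simp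
  obtain ys e where ys: "trace 0 ?H1 = ys @ [Rise, Tip (-1) (Suc e)]" using trace_root_snoc[OF wf(1)] by blast
  obtain xs d where xs: "trace 0 ?H2 = xs @ [Rise, Tip (-1) (Suc d)]" using trace_root_snoc[OF wf(2)] by blast
  let ?ys = "map (map_token (\<lambda>a. a + int r)) (ys @ [Rise])"
  have S: "trace r ?S = ?ys @ [Tip (-1) (Suc (Suc e))]"
    using trace_shift_root[of hs "ys @ [Rise]" "Suc e" r] wf(1) H1 ys r by (simp del: trace.simps)
  have lys: "int r - 1 \<le> a" if a: "a \<in> set (labels ?ys)" for a
  proof -
    have l: "leaves ?H1 = labels ys @ [-1]" using arg_cong[OF ys, of labels] by (simp del: trace.simps)
    obtain b where "a = b + int r" "b \<in> set (labels ys)" using a by auto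
    then show ?thesis using wf_at_leaves[OF wf(1), of b] l by simp
  qed
  have tr: "trace 0 (graft ?S ?H2) = (xs @ [Rise]) @ ?ys @ [Tip (-1) (Suc d + Suc e)]"
    by (rule trace_graft[OF wf(2)]) (use xs S lys in \<open>auto simp: r_def\<close>)
  have "mir (Q_path ?T2) = (path_of xs @ [Up]) @ replicate (Suc d) Down"
    using multi(4) xs by (simp del: trace.simps)
  from mir_append[OF dyck_Q_path[of ?T1] dyck_Q_path[of ?T2] this]
  have "mir (Q_path ?T1 @ Q_path ?T2) = (path_of xs @ [Up]) @ mir (Q_path ?T1) @ replicate (Suc d) Down"
    by simp
  moreover have "mir (Q_path ?T1) = path_of ys @ [Up] @ replicate (Suc e) Down"
    using multi(3) ys by (simp del: trace.simps)
  \<comment> \<open>The final runs of the inserted mirror and of its surroundings meet in the single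
    last tip of the graft.\<close>
  moreover have "replicate (Suc d + Suc e) Down = replicate (Suc e) Down @ replicate (Suc d) Down"
    by (metis add.commute replicate_add)
  ultimately have Q: "mir (Q_path (Node (t # u # us))) = path_of (trace 0 (graft ?S ?H2))"
    unfolding tr by simp
  obtain X where X: "Q_path ?H2 = X @ replicate r Down" "X \<noteq> []" "last X = Up"
    "\<And>s. Q_path (graft s ?H2) = X @ Q_path s @ replicate r Down"
    using Q_path_graft[OF wf(2)] r unfolding r_def by metis
  have "mir (path_of (trace 0 ?T1) @ path_of (trace 0 ?T2)) =
      X @ mir (path_of (trace 0 ?T1)) @ replicate r Down"
    using multi(4) X(1) by (intro mir_append[OF dyck_trace[OF multi(1)] dyck_trace[OF multi(2)] _ X(2,3)]) simp
  then have P: "mir (path_of (trace 0 (Node (t # u # us)))) = Q_path (graft ?S ?H2)"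
    using multi(3) X(4)[of ?S] unfolding T by simp
  obtain ls where ls: "leaves ?H1 = ls @ [-1]" using last_leaf[OF wf(1)] by blast
  then have lS: "leaves ?S = map (\<lambda>a. a + int r) ls @ [-1]" using leaves_shift[OF wf(1)] by simp
  have "wf_at r ?S" using wf_shift[OF wf(1), of r] ls by simp
  moreover have "-1 \<le> a" if "a \<in> set ls" for a using wf_at_leaves[OF wf(1), of a] ls that by simp
  ultimately have "wf_at 0 (graft ?S ?H2)"
    by (intro wf_graft[OF wf(2) _ _ lS]) (use last_leaf[OF wf(2)] in \<open>auto simp: r_def\<close>)
  moreover have "rpath (graft ?S ?H2) = free_leaves (Node (t # u # us))"
    using rpath_graft[OF wf(2)] multi(3,4) by (simp add: free_leaves_def r_def)
  ultimately show ?case using P Q h by simp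
qed

section \<open>Surjectivity onto synchronized intervals\<close>

lemma dyck_iff_prefix:
  "dyck w \<longleftrightarrow> count_list w Up = count_list w Down \<and>
    (\<forall>u v. w = u @ v \<longrightarrow> count_list u Down \<le> count_list u Up)"
  unfolding dyck_def by (metis append_eq_conv_conj append_take_drop_id le_refl length_append le_add1)

lemma dyck_prefix: "dyck (u @ v) \<Longrightarrow> count_list u Down \<le> count_list u Up"
  by (auto simp: dyck_iff_prefix)

lemma dyck_append_left: "dyck (v @ w) \<Longrightarrow> dyck w \<Longrightarrow> dyck v"
  unfolding dyck_iff_prefix by fastforce

lemma dyck_append_right:
  assumes "dyck (v @ w)" "dyck v"
  shows "dyck w"
proof -
  have "count_list u Down \<le> count_list u Up" if "w = u @ x" for u x
    using dyck_prefix[of "v @ u" x] assms that by (simp add: dyck_iff_prefix)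
  then show ?thesis using assms by (auto simp: dyck_iff_prefix)
qed

lemma dyck_shift_down:
  assumes "dyck (V @ Down # D @ W)" "dyck D"
  shows "dyck (V @ D @ Down # W)"
  unfolding dyck_iff_prefix
proof (intro conjI allI impI)
  show "count_list (V @ D @ Down # W) Up = count_list (V @ D @ Down # W) Down"
    using assms(1) by (simp add: dyck_iff_prefix)
  fix u v assume eq: "V @ D @ Down # W = u @ v"
  have V: "count_list V Down < count_list V Up"
    using dyck_prefix[of "V @ [Down]" "D @ W"] assms(1) by simp
  consider x where "V = u @ x" | x y where "u = V @ x" "D = x @ y"
    | x where "u = V @ D @ Down # x" "W = x @ v"
    using eq unfolding append_eq_append_conv2 by (auto simp: append_eq_Cons_conv Cons_eq_append_conv)
  then show "count_list u Down \<le> count_list u Up"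
  proof cases
    case 1
    then show ?thesis using dyck_prefix[of u "x @ Down # D @ W"] assms(1) by simp
  next
    case 2
    then show ?thesis using V dyck_prefix[of x y] assms(2) by simp
  next
    case 3
    then show ?thesis using dyck_prefix[of "V @ Down # D @ x" v] assms(1) by simp
  qed
qed

lemma dyck_last: "dyck w \<Longrightarrow> w \<noteq> [] \<Longrightarrow> last w = Down"
  using dyck_decomp_exists[of w] by auto

lemma dyck_hd: "dyck w \<Longrightarrow> w \<noteq> [] \<Longrightarrow> hd w = Up"
  by (cases w; cases "hd w") (use dyck_prefix[of "[hd w]" "tl w"] in auto)

lemma dyck_count_Up: "dyck w \<Longrightarrow> w \<noteq> [] \<Longrightarrow> count_list w Up > 0"
  using dyck_decomp_exists[of w] by auto

lemma dyck_first_return: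
  assumes "dyck w" "w \<noteq> []"
  shows "\<exists>L R. dyck L \<and> dyck R \<and> w = Up # L @ Down # R"
proof -
  obtain rs where rs: "\<forall>r\<in>set rs. prime_path r" "w = concat rs" using dyck_primes assms(1) by blast
  then obtain r rs' where "rs = r # rs'" using assms(2) by (cases rs) auto
  then show ?thesis using rs dyck_concat[of rs'] by (auto simp: prime_path_def)
qed

lemma prime_concat_unique:
  "\<forall>r\<in>set rs. prime_path r \<Longrightarrow> \<forall>r\<in>set rs'. prime_path r \<Longrightarrow> concat rs = concat rs' \<Longrightarrow> rs = rs'"
proof (induction rs arbitrary: rs' rule: rev_induct)
  case Nil
  then show ?case by (cases rs') (auto simp: prime_path_def)
next
  case (snoc r rs)
  obtain D where D: "dyck D" "r = Up # D @ [Down]" using snoc(2) by (auto simp: prime_path_def)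
  then have "rs' \<noteq> []" using snoc(4) by auto
  then obtain r' rs'' where rs': "rs' = rs'' @ [r']" by (metis rev_exhaust)
  obtain D' where D': "dyck D'" "r' = Up # D' @ [Down]" using snoc(3) rs' by (auto simp: prime_path_def)
  have "concat rs = concat rs'' \<and> D = D'"
    using snoc(2-4) D D' by (intro dyck_decomp_unique) (auto simp: rs' intro!: dyck_concat)
  then show ?case using snoc.IH[of rs''] snoc(2,3) rs' D D' by simp
qed

section \<open>The Tamari order under splitting and deletion\<close>

lemma tamari_le_count: "tamari_le P Q \<Longrightarrow> count_list P Up = count_list Q Up"
  unfolding tamari_le_def by (induction rule: rtranclp_induct) (auto simp: tamari_step_def)

text \<open>A return of the upper path is also one of the lower path: the block
  \<open>D @ [Down]\<close> cannot straddle the cut, so the step happens inside one factor.\<close>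

lemma tamari_step_append:
  assumes step: "tamari_step P (A @ B)" and A: "dyck A" and B: "dyck B"
  shows "\<exists>A' B'. P = A' @ B' \<and> dyck A' \<and> dyck B' \<and> tamari_le A' A \<and> tamari_le B' B"
proof -
  obtain V D W where D: "dyck D" "D \<noteq> []" and P: "P = V @ [Down] @ D @ W" "dyck P"
    and eq: "A @ B = V @ D @ [Down] @ W"
    using step unfolding tamari_step_def by blast
  \<comment> \<open>A suffix \<open>y\<close> of \<open>D\<close> has no surplus of up steps, so
    \<open>y @ [Down]\<close> would take \<open>B\<close> below the axis.\<close>
  have imp: "False" if "D = x @ y" "B = y @ Down # z" for x y z
  proof -
    have "count_list D Up = count_list D Down" using D(1) by (simp add: dyck_def)
    then have "count_list y Up \<le> count_list y Down"
      using dyck_prefix[of x y] D(1) that(1) by simp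
    then show ?thesis using dyck_prefix[of "y @ [Down]" z] B that(2) by simp
  qed
  have inner: "\<exists>z. x = D @ [Down] @ z \<and> W = z @ B" if x: "x @ B = D @ [Down] @ W" for x
  proof -
    obtain y where "(x = D @ y \<and> y @ B = Down # W) \<or> (x @ y = D \<and> B = y @ Down # W)"
      using x by (auto simp: append_eq_append_conv2)
    then have y: "x = D @ y" "y @ B = Down # W" using imp by blast+
    then show ?thesis using imp[of D "[]" W] by (cases y) auto
  qed
  consider x where "A = V @ x" "x @ B = D @ [Down] @ W" | x where "V = A @ x" "B = x @ D @ [Down] @ W"
    using eq by (auto simp: append_eq_append_conv2)
  then consider x where "A = V @ D @ [Down] @ x" "W = x @ B" | x where "V = A @ x" "B = x @ D @ [Down] @ W"
    using inner by metis
  then show ?thesis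
  proof cases
    case 1
    let ?A' = "V @ [Down] @ D @ x"
    have "dyck ?A'" using dyck_append_left[of ?A' B] P B 1 by simp
    moreover from this have "tamari_step ?A' A" unfolding tamari_step_def using A D 1 by blast
    ultimately show ?thesis using P 1 B
      by (intro exI[of _ ?A'] exI[of _ B]) (auto simp: tamari_le_def)
  next
    case 2
    let ?B' = "x @ [Down] @ D @ W"
    have "dyck ?B'" using dyck_append_right[of A ?B'] P A 2 by simp
    moreover from this have "tamari_step ?B' B" unfolding tamari_step_def using B D 2 by blast
    ultimately show ?thesis using P 2 A
      by (intro exI[of _ A] exI[of _ ?B']) (auto simp: tamari_le_def)
  qed
qed

lemma tamari_le_append:
  assumes "tamari_le P (A @ B)" "dyck A" "dyck B"
  shows "\<exists>A' B'. P = A' @ B' \<and> dyck A' \<and> dyck B' \<and> tamari_le A' A \<and> tamari_le B' B"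
  using assms(1) unfolding tamari_le_def
proof (induction rule: converse_rtranclp_induct)
  case base
  then show ?case using assms(2,3) by blast
next
  case (step P P')
  then obtain A' B' where P': "P' = A' @ B'" "dyck A'" "dyck B'"
    "tamari_step\<^sup>*\<^sup>* A' A" "tamari_step\<^sup>*\<^sup>* B' B" by blast
  obtain A'' B'' where "P = A'' @ B''" "dyck A''" "dyck B''" "tamari_step\<^sup>*\<^sup>* A'' A'" "tamari_step\<^sup>*\<^sup>* B'' B'"
    using tamari_step_append[of P A' B'] step(1) P'(1-3) unfolding tamari_le_def by blast
  moreover from this have "tamari_step\<^sup>*\<^sup>* A'' A" "tamari_step\<^sup>*\<^sup>* B'' B"
    using P'(4,5) by auto
  ultimately show ?case by blast
qed

text \<open>If the moved down step matches the first up step, deletion hides the move; otherwise the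
  same move takes place in \<open>L\<close> or in \<open>R\<close>.\<close>

lemma tamari_step_delete:
  assumes step: "tamari_step (Up # L @ Down # R) P" and L: "dyck L" and R: "dyck R"
  shows "\<exists>L' R'. P = Up # L' @ Down # R' \<and> dyck L' \<and> dyck R' \<and> tamari_le (L @ R) (L' @ R')"
proof -
  obtain V D W where D: "dyck D" "D \<noteq> []" and P: "P = V @ D @ [Down] @ W"
    and eq: "Up # L @ Down # R = V @ [Down] @ D @ W"
    using step unfolding tamari_step_def by blast
  obtain V' where V: "V = Up # V'" using eq by (cases V) auto
  then have eq': "L @ Down # R = V' @ Down # D @ W" using eq by simp
  \<comment> \<open>\<open>D\<close> cannot start inside \<open>L\<close> and run past the matching
    down step: the rest \<open>x\<close> of \<open>L\<close> has no surplus, so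
    \<open>x @ [Down]\<close> would take \<open>D\<close> below the axis.\<close>
  have imp: "False" if "L = V' @ Down # x" "D = x @ Down # y" for x y
  proof -
    have "count_list V' Down < count_list V' Up"
      using dyck_prefix[of "V' @ [Down]" x] L that(1) by simp
    then have "count_list x Up \<le> count_list x Down" using L that(1) by (simp add: dyck_iff_prefix)
    then show ?thesis using dyck_prefix[of "x @ [Down]" y] D(1) that(2) by simp
  qed
  consider "V' = L" "R = D @ W" | x where "V' = L @ Down # x" "R = x @ Down # D @ W"
    | x where "L = V' @ Down # D @ x" "W = x @ Down # R"
    using eq' imp unfolding append_eq_append_conv2
    by (auto simp: append_eq_Cons_conv Cons_eq_append_conv append_eq_append_conv2)
  then show ?thesis
  proof cases
    case 1
    have "dyck W" using dyck_append_right[of D W] R D 1 by simp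
    moreover have "dyck (L @ D)" using L D dyck_append by blast
    ultimately show ?thesis using P V 1
      by (intro exI[of _ "L @ D"] exI[of _ W]) (auto simp: tamari_le_def)
  next
    case 2
    let ?R' = "x @ D @ Down # W"
    have R': "dyck ?R'" using dyck_shift_down R D 2 by simp
    then have "dyck (L @ R)" "dyck (L @ ?R')" using L R dyck_append by blast+
    moreover have "L @ R = (L @ x) @ [Down] @ D @ W" "L @ ?R' = (L @ x) @ D @ [Down] @ W"
      using 2 by simp_all
    ultimately have "tamari_step (L @ R) (L @ ?R')"
      unfolding tamari_step_def using D by blast
    then show ?thesis using P V 2 L R'
      by (intro exI[of _ L] exI[of _ ?R']) (auto simp: tamari_le_def)
  next
    case 3
    let ?L' = "V' @ D @ Down # x"
    have L': "dyck ?L'" using dyck_shift_down L D 3 by simp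
    then have "dyck (L @ R)" "dyck (?L' @ R)" using L R dyck_append by blast+
    moreover have "L @ R = V' @ [Down] @ D @ (x @ R)" "?L' @ R = V' @ D @ [Down] @ (x @ R)"
      using 3 by simp_all
    ultimately have "tamari_step (L @ R) (?L' @ R)"
      unfolding tamari_step_def using D by blast
    then show ?thesis using P V 3 R L'
      by (intro exI[of _ ?L'] exI[of _ R]) (auto simp: tamari_le_def)
  qed
qed

lemma tamari_le_delete:
  assumes "tamari_le (Up # L @ Down # R) (Up # Q @ [Down])" "dyck L" "dyck R" "dyck Q"
  shows "tamari_le (L @ R) Q"
proof -
  \<comment> \<open>\<open>L\<close> and \<open>R\<close> are generalized because the matching down
    step may move along the chain.\<close>
  have "\<forall>L R. P = Up # L @ Down # R \<and> dyck L \<and> dyck R \<longrightarrow> tamari_le (L @ R) Q"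
    if "tamari_step\<^sup>*\<^sup>* P (Up # Q @ [Down])" for P
    using that
  proof (induction rule: converse_rtranclp_induct)
    case base
    show ?case
    proof (intro allI impI)
      fix L R assume *: "Up # Q @ [Down] = Up # L @ Down # R \<and> dyck L \<and> dyck R"
      \<comment> \<open>An earlier match would make \<open>L @ [Down]\<close> a prefix of the Dyck
        path \<open>Q\<close>.\<close>
      have "R = []"
      proof (rule ccontr)
        assume "R \<noteq> []"
        then obtain R' x where "R = R' @ [x]" by (metis rev_exhaust)
        then have "Q = (L @ [Down]) @ R'" using * by simp
        then show False using dyck_prefix[of "L @ [Down]" R'] assms(4) * by (simp add: dyck_def)
      qed
      then show "tamari_le (L @ R) Q" using * by (simp add: tamari_le_def)
    qed
  next
    case (step P P')
    then show ?case using tamari_step_delete unfolding tamari_le_def by (metis rtranclp_trans)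
  qed
  then show ?thesis using assms unfolding tamari_le_def by blast
qed

section \<open>Letters of up steps and types\<close>

lemma up_letters_append: "v = [] \<or> last v = Down \<Longrightarrow> up_letters (v @ w) = up_letters v @ up_letters w"
  by (induction v rule: up_letters.induct) (auto split: if_splits)

lemma length_up_letters: "length (up_letters w) = count_list w Up"
  by (induction w rule: up_letters.induct) auto

lemma last_up_letters: "up_letters w \<noteq> [] \<Longrightarrow> last (up_letters w) = North"
proof (induction w rule: up_letters.induct)
  case (3 w)
  have "hd w \<noteq> Up" if "up_letters w = []" "w \<noteq> []" using that by (cases w rule: up_letters.cases) auto
  then show ?case using 3 by auto
qed auto

text \<open>The last up step always has letter \<open>North\<close>, so dropping it loses nothing
  once the numbers of up steps agree.\<close>

lemma dyck_type_up_letters: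
  assumes "dyck_type P = dyck_type Q" "count_list P Up = count_list Q Up"
  shows "up_letters P = up_letters Q"
  using assms length_up_letters[of P] length_up_letters[of Q] last_up_letters[of P] last_up_letters[of Q]
  unfolding dyck_type_def by (metis append_butlast_last_id length_0_conv)

section \<open>Undoing the deletion of the root\<close>

lemma map_ltree_preimage:
  "map f xs = leaves t \<Longrightarrow> \<exists>t'. map_ltree f t' = t \<and> leaves t' = xs"
proof (induction t arbitrary: xs)
  case (Leaf a)
  then show ?case by (intro exI[of _ "Leaf (hd xs)"]) auto
next
  case (Node ts)
  have "\<exists>ts'. map (map_ltree f) ts' = ts \<and> concat (map leaves ts') = xs"
    using Node
  proof (induction ts arbitrary: xs)
    case Nil
    then show ?case by simp
  next
    case (Cons t ts)
    then obtain us vs where xs: "xs = us @ vs" "map f us = leaves t" "map f vs = leaves (Node ts)"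
      by (auto simp: map_eq_append_conv)
    obtain t' where "map_ltree f t' = t \<and> leaves t' = us" using Cons(2)[of t us] xs by auto
    moreover obtain ts' where "map (map_ltree f) ts' = ts \<and> concat (map leaves ts') = vs"
      using Cons.IH[of vs] Cons(2) xs by auto
    ultimately show ?case using xs by (intro exI[of _ "t' # ts'"]) simp
  qed
  then obtain ts' where "map (map_ltree f) ts' = ts \<and> concat (map leaves ts') = xs" by blast
  then show ?case by (intro exI[of _ "Node ts'"]) simp
qed

lemma guarded_mapD:
  assumes "guarded q (map f xs)" "f p = q" "\<And>x. x \<in> set xs \<Longrightarrow> q \<le> f x \<Longrightarrow> p \<le> x"
  shows "guarded p xs"
  using assms by (auto simp: guarded_nth)

text \<open>Converse of \<open>wf_Pi_tree\<close>. For \<open>p = 0\<close> the former root must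
  satisfy condition (2) at depth 1, hence the free leaf.\<close>

lemma wf_Pi_treeD:
  assumes "wf_at p (Pi_tree t)" "\<forall>a\<in>set (leaves t). -1 \<le> a" "p = 0 \<longrightarrow> -1 \<in> set (leaves t)"
  shows "wf_at (Suc p) t"
  using assms
proof (induction t arbitrary: p)
  case (Leaf a)
  then show ?case by (auto simp: Pi_tree_def split: if_splits)
next
  case (Node ts)
  define f :: "int \<Rightarrow> int" where "f a = (if a = -1 then -1 else a - 1)" for a
  have Pi: "Pi_tree = map_ltree f" by (simp add: Pi_tree_def[abs_def] f_def[abs_def])
  have wf: "ts \<noteq> []" "p > 0 \<longrightarrow> (\<exists>t\<in>set ts. \<exists>a\<in>set (leaves t). f a \<le> int p - 2)"
    "\<And>t. t \<in> set ts \<Longrightarrow> guarded (int p) (map f (leaves t)) \<and> wf_at (Suc p) (Pi_tree t)"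
    using Node(2) by (auto simp: Pi)
  have "guarded (int (Suc p)) (leaves t)" if t: "t \<in> set ts" for t
    by (rule guarded_mapD[of "int p" f]) (use wf(3) t in \<open>auto simp: f_def split: if_splits\<close>)
  moreover have "wf_at (Suc (Suc p)) t" if t: "t \<in> set ts" for t
    using Node(1)[OF t, of "Suc p"] wf(3)[OF t] Node(3) t by auto
  moreover have "\<exists>t\<in>set ts. \<exists>a\<in>set (leaves t). a \<le> int (Suc p) - 2"
  proof (cases "p = 0")
    case True
    then show ?thesis using Node(4) by force
  next
    case False
    then obtain t a where "t \<in> set ts" "a \<in> set (leaves t)" "f a \<le> int p - 2" using wf(2) by auto
    then show ?thesis by (intro bexI[of _ t] bexI[of _ a]) (auto simp: f_def split: if_splits)
  qed
  ultimately show ?case using wf(1) by auto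
qed

text \<open>Since 0 and -1 have the same image, each free leaf of \<open>T\<close> allows a choice:
  0 before the end of \<open>L\<close>, and -1 from there on. The first leaf left free then
  certifies the new inner node and closes the first segment right after \<open>L\<close>.\<close>

lemma Pi_tree_preimage:
  assumes wf: "wf_at 0 T" and L: "dyck L" "L \<noteq> []" and R: "dyck R" and P: "path_of (trace 0 T) = L @ R"
  shows "\<exists>ts. wf_at 0 (Node [Node ts]) \<and> Pi_tree (Node ts) = T \<and>
    path_of (trace 0 (Node [Node ts])) = Up # L @ Down # R"
proof -
  define f :: "int \<Rightarrow> int" where "f a = (if a = -1 then -1 else a - 1)" for a
  have Pi: "Pi_tree = map_ltree f" by (simp add: Pi_tree_def[abs_def] f_def[abs_def])
  obtain segs where segs: "trace 0 T = concat segs" "\<forall>s\<in>set segs. segment s"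
    using segments[OF wf] by blast
  obtain ls where ls: "\<forall>r\<in>set ls. prime_path r" "L = concat ls" using dyck_primes[OF L(1)] by blast
  obtain rs where rs: "\<forall>r\<in>set rs. prime_path r" "R = concat rs" using dyck_primes[OF R] by blast
  have "map path_of segs = ls @ rs"
    by (rule prime_concat_unique)
      (use segs ls rs P in \<open>auto simp: segment_def path_of_concat\<close>)
  then have len: "length segs = length ls + length rs" by (metis length_append length_map)
  \<comment> \<open>The last segment of \<open>L\<close> goes to the second part, since its final
    leaf is to be the first free one.\<close>
  define a where "a = length ls - 1"
  have a: "length segs - a = Suc (length rs)" using L(2) ls(2) len by (cases ls) (auto simp: a_def)
  define us vs where "us = labels (concat (take a segs))" and "vs = labels (concat (drop a segs))"
  have uv: "us @ vs = leaves T"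
    using arg_cong[OF segs(1), of labels] unfolding us_def vs_def
    by (metis append_take_drop_id concat_append labels_append labels_trace)
  have ge: "-1 \<le> x" if "x \<in> set us \<union> set vs" for x
    using wf_at_leaves[OF wf, of x] that uv[symmetric] by auto
  define us' where "us' = map (\<lambda>x. x + 1) us"
  define vs' where "vs' = map (\<lambda>x. if x = -1 then -1 else x + 1) vs"
  have us': "\<forall>x\<in>set us'. 0 \<le> x" using ge by (force simp: us'_def)
  have vs': "\<forall>x\<in>set vs'. -1 \<le> x \<and> x \<noteq> 0" using ge by (force simp: vs'_def)
  have "map f us' = us" "map f vs' = vs"
    unfolding us'_def vs'_def map_map by (rule map_idI, use ge in \<open>force simp: f_def\<close>)+
  then have "map f (us' @ vs') = us @ vs" by simp
  then obtain t where t: "map_ltree f t = T" "leaves t = us' @ vs'"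
    using map_ltree_preimage uv by metis
  have "count_list vs (-1) = Suc (length rs)"
    using count_segments[of "drop a segs"] segs(2) a unfolding vs_def by (auto dest: in_set_dropD)
  moreover have "count_list vs' (-1) = count_list vs (-1)"
  proof -
    have "count_list (map (\<lambda>x. if x = -1 then -1 else x + 1) zs) (-1) = count_list zs (-1 :: int)"
      if "\<forall>z\<in>set zs. -1 \<le> z" for zs
      using that by (induction zs) auto
    then show ?thesis using ge by (simp add: vs'_def)
  qed
  moreover have "count_list us' (-1) = 0" using us' by (force intro!: count_notin)
  ultimately have free: "count_list (leaves t) (-1) = Suc (length rs)" using t(2) by simp
  then have "-1 \<in> set (leaves t)" by (metis count_notin nat.distinct(1))
  then have "wf_at (Suc 0) t"
    using wf t us' vs' by (intro wf_Pi_treeD) (auto simp: Pi)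
  \<comment> \<open>Condition (3) at the new root: zeros occur only in \<open>us'\<close>, where no
    label is negative.\<close>
  moreover have "guarded 0 (leaves t)"
    using us' vs' unfolding t(2) guarded_append by (auto simp: guarded_def)
  ultimately have wf': "wf_at 0 (Node [t])" by simp
  obtain ts where ts: "t = Node ts" using t(1) wf by (cases t) auto
  have "trace 0 (Pi_tree (Node ts)) = concat segs" using t(1) ts segs(1) Pi by simp
  then obtain Pl S segs' where Pl: "L @ R = Pl @ path_of (concat segs')" "dyck Pl"
    and S: "path_of S = Up # Pl @ [Down]" and T: "trace 0 (Node [t]) = concat (S # segs')"
    and seg: "\<forall>s\<in>set (S # segs'). segment s"
    using trace_single[OF wf'[unfolded ts] _ segs(2)] P t(1) Pi unfolding ts by metis
  \<comment> \<open>Counting free leaves gives \<open>segs'\<close> as many members as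
    \<open>R\<close> has prime factors, which identifies \<open>Pl\<close> with
    \<open>L\<close>.\<close>
  have "length (S # segs') = count_list (leaves (Node [t])) (-1)"
    using count_segments[OF seg] T labels_trace by metis
  then have len': "length (map path_of segs') = length rs" using free by simp
  obtain ps where ps: "\<forall>r\<in>set ps. prime_path r" "Pl = concat ps" using dyck_primes[OF Pl(2)] by blast
  have "ps @ map path_of segs' = ls @ rs"
    by (rule prime_concat_unique)
      (use seg ls rs ps Pl in \<open>auto simp: segment_def path_of_concat\<close>)
  then have "ps = ls" "map path_of segs' = rs" using len' by (auto simp: append_eq_append_conv)
  then have "path_of (trace 0 (Node [t])) = Up # L @ Down # R"
    unfolding T using S ps ls rs by (simp add: path_of_concat)
  then show ?thesis using wf' t(1) ts Pi by auto
qed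

text \<open>An inner return of \<open>Q\<close> splits both paths, and the two trees are joined at
  their roots; otherwise the outer steps of \<open>Q\<close> are removed and the deletion of the
  root is undone.\<close>

lemma sync_interval_tree:
  "dyck P \<Longrightarrow> dyck Q \<Longrightarrow> tamari_le P Q \<Longrightarrow> up_letters P = up_letters Q \<Longrightarrow> Q \<noteq> [] \<Longrightarrow>
    \<exists>T. wf_at 0 T \<and> path_of (trace 0 T) = P \<and> Q_path T = Q"
proof (induction Q arbitrary: P rule: length_induct)
  case (1 Q)
  note IH = 1(1)[rule_format]
  obtain A B where Q: "dyck A" "dyck B" "Q = Up # A @ Down # B"
    using dyck_first_return 1(3,6) by blast
  show ?case
  proof (cases "B = []")
    case False
    let ?A = "Up # A @ [Down]"
    have A: "dyck ?A" using dyck_compose[of "[]" A] Q(1) by simp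
    have "tamari_le P (?A @ B)" using 1(4) Q(3) by simp
    then obtain P1 P2 where P: "P = P1 @ P2" "dyck P1" "dyck P2" "tamari_le P1 ?A" "tamari_le P2 B"
      using tamari_le_append A Q(2) by blast
    have "up_letters P = up_letters P1 @ up_letters P2"
      using up_letters_append[of P1 P2] P(1) dyck_last[OF P(2)] by blast
    moreover have "Q = ?A @ B" "last ?A = Down" by (simp_all add: Q(3))
    then have "up_letters Q = up_letters ?A @ up_letters B"
      using up_letters_append[of ?A B] by metis
    ultimately have "up_letters P1 @ up_letters P2 = up_letters ?A @ up_letters B"
      using 1(5) by simp
    \<comment> \<open>Equal numbers of up steps cut both letter lists at the same place.\<close>
    moreover have "length (up_letters P1) = length (up_letters ?A)"
      using tamari_le_count[OF P(4)] by (simp only: length_up_letters)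
    ultimately have up: "up_letters P1 = up_letters ?A" "up_letters P2 = up_letters B"
      by (metis append_eq_append_conv)+
    obtain T1 where T1: "wf_at 0 T1" "path_of (trace 0 T1) = P1" "Q_path T1 = ?A"
      using IH[of ?A P1] P A up False Q(3) by auto
    obtain T2 where T2: "wf_at 0 T2" "path_of (trace 0 T2) = P2" "Q_path T2 = B"
      using IH[of B P2] P Q up False by auto
    obtain ts us where Ts: "T1 = Node ts" "T2 = Node us" using T1(1) T2(1) by (cases T1; cases T2) auto
    have "path_of (trace 0 (Node (ts @ us))) = P"
      using trace_multi[of ts us] T1 T2 Ts P(1) by (simp del: trace.simps)
    then show ?thesis using T1 T2 Ts Q(3) by (intro exI[of _ "Node (ts @ us)"]) (auto simp del: trace.simps)
  next
    case True
    then have QA: "Q = Up # A @ [Down]" using Q by simp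
    have "P \<noteq> []" using tamari_le_count[OF 1(4)] QA by auto
    then obtain L R where P: "dyck L" "dyck R" "P = Up # L @ Down # R"
      using dyck_first_return 1(2) by blast
    have le: "tamari_le (L @ R) A" using tamari_le_delete[of L R A] 1(4) P Q(1) QA by simp
    have LR: "dyck (L @ R)" using P dyck_append by blast
    show ?thesis
    proof (cases "A = []")
      case True
      then have "L @ R = []" using tamari_le_count[OF le] dyck_count_Up[OF LR] by force
      then show ?thesis using P QA True by (intro exI[of _ "Node [Leaf (-1)]"]) auto
    next
      case False
      then have hA: "hd (A @ [Down]) = Up" using dyck_hd Q(1) by simp
      have upQ: "up_letters Q = East # up_letters A"
        using hA dyck_last[OF Q(1) False] up_letters_append[of A "[Down]"] by (simp add: QA)
      \<comment> \<open>\<open>Q\<close> starts with two up steps, and equality of letters gives the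
        same for \<open>P\<close>; so \<open>L\<close> is nonempty, as
        \<open>Pi_tree_preimage\<close> requires.\<close>
      then have hL: "hd (L @ Down # R) = Up" using 1(5) P(3) by (auto split: if_splits)
      then have Ln: "L \<noteq> []" by auto
      have "up_letters P = East # up_letters L @ up_letters R"
        using hL dyck_last[OF P(1) Ln] up_letters_append[of L "Down # R"] by (simp add: P(3))
      then have "up_letters (L @ R) = up_letters A"
        using 1(5) upQ dyck_last[OF P(1) Ln] up_letters_append[of L R] by simp
      then obtain T where T: "wf_at 0 T" "path_of (trace 0 T) = L @ R" "Q_path T = A"
        using IH[of A "L @ R"] LR Q(1) le False QA by auto
      obtain ts where ts: "wf_at 0 (Node [Node ts])" "Pi_tree (Node ts) = T"
        "path_of (trace 0 (Node [Node ts])) = Up # L @ Down # R"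
        using Pi_tree_preimage[OF T(1) P(1) Ln P(2) T(2)] by blast
      have "Q_path (Node ts) = A" using T(3) ts(2) by (metis Pi_tree_def Q_path_map_ltree)
      then show ?thesis using ts P(3) QA by (intro exI[of _ "Node [Node ts]"]) auto
    qed
  qed
qed

lemma count_Q_path: "count_list (Q_path t) Up = edges t"
proof (induction t)
  case (Node ts)
  then show ?case by (induction ts) auto
qed simp

lemma interval_of_surj:
  assumes "n \<ge> 1" "S \<in> sync_intervals n"
  shows "S \<in> interval_of ` decorated_trees n"
proof -
  obtain P Q where S: "S = (P, Q)" "dyck P" "dyck Q" "count_list P Up = n" "count_list Q Up = n"
    "tamari_le P Q" "dyck_type P = dyck_type Q"
    using assms(2) by (auto simp: sync_intervals_def dyck_size_def)
  have "up_letters P = up_letters Q" using dyck_type_up_letters[of P Q] S(4,5,7) by simp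
  moreover have "Q \<noteq> []" using assms(1) S(5) by auto
  ultimately obtain T where T: "wf_at 0 T" "path_of (trace 0 T) = P" "Q_path T = Q"
    using sync_interval_tree[of P Q] S by blast
  have "edges T = n" using count_Q_path[of T] T(3) S(5) by simp
  then show ?thesis using T S(1)
    by (intro image_eqI[of _ _ T])
      (simp_all add: interval_of_def P_path_trace decorated_iff decorated_trees_def)
qed

theorem theorem4p9:
  shows "(\<forall>T. decorated T \<longrightarrow>
            decorated (h_tree T) \<and> mir_interval (interval_of T) = interval_of (h_tree T)) \<and>
         (\<forall>n\<ge>1. \<forall>S\<in>sync_intervals n.
            mir_interval S =
              (interval_of \<circ> h_tree \<circ> inv_into (decorated_trees n) interval_of) S)"
proof -
  have tree: "decorated (h_tree T) \<and> mir_interval (interval_of T) = interval_of (h_tree T)"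
    if "decorated T" for T
    using h_tree_mirror[of T] P_path_trace that
    by (simp add: decorated_iff mir_interval_def interval_of_def)
  moreover have "mir_interval S = (interval_of \<circ> h_tree \<circ> inv_into (decorated_trees n) interval_of) S"
    if "n \<ge> 1" "S \<in> sync_intervals n" for n S
  proof -
    \<comment> \<open>Whichever preimage \<open>inv_into\<close> selects, the statement for trees
      applies to it.\<close>
    let ?T = "inv_into (decorated_trees n) interval_of S"
    have "?T \<in> decorated_trees n" "interval_of ?T = S"
      using interval_of_surj[OF that] by (simp_all add: inv_into_into f_inv_into_f)
    then show ?thesis using tree[of ?T] by (simp add: decorated_trees_def)
  qed
  ultimately show ?thesis by blast
qed

end
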